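(* Let $0 < d \leq 1$. Then for all sufficiently large primes $p$ the following holds: if $S \subseteq \mathbb{Z}/p\mathbb{Z}$ is a critical set for the density $d$, then $S$ contains an arithmetic progression modulo $p$ of length at least $\log^{1/4+o(1)} p$. Moreover, for every $L \geq 1$, every $0 < d \leq 1$, and all sufficiently large primes $p$, if $S \subseteq \mathbb{Z}/p\mathbb{Z}$ is a critical set for the density $d$, then there exists an arithmetic progression $N \subseteq \mathbb{Z}/p\mathbb{Z}$ of length at least $\log^L p$ such that $$|S \cap N| \;>\; |N|\left(1 - \frac{1}{\log^{1/4+o(1)} p}\right).$$
   Context: A three-term arithmetic progression (3AP) in $\mathbb{Z}/p\mathbb{Z}$ is an ordered triple of residue classes $n, n+m, n+2m$ modulo $p$. This includes the trivial progressions ($m \equiv 0 \pmod p$) as well as the non-trivial ones ($m \not\equiv 0 \pmod p$), and progressions are counted as ordered triples, so that $n, n+m, n+2m$ and $n+2m, n+m, n$ are counted as different progressions. Equivalently, the number of 3AP's in $S$ is the number of triples $(r,s,t) \in S^3$ with $r + s \equiv 2t \pmod p$. Given a prime $p$ and $0<d\le 1$, a set $S \subseteq \mathbb{Z}/p\mathbb{Z}$ is a critical set for the density $d$ if $|S| \geq dp$ and $S$ has the least number of 3AP's among all subsets of $\mathbb{Z}/p\mathbb{Z}$ having at least $dp$ elements. An arithmetic progression modulo $p$ of length $\ell$ is a set $\{a, a+b, \dots, a+(\ell-1)b\}$ of residues modulo $p$. The $o(1)$ terms denote quantities tending to $0$ as $p \to \infty$. *)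

theory Defs
  imports Complex_Main "HOL-Number_Theory.Cong" "HOL-Computational_Algebra.Primes"
begin

text \<open>Residue classes modulo \<open>p\<close> are represented by the integers \<open>0, \<dots>, p - 1\<close>.\<close>

definition residue_classes :: "nat \<Rightarrow> int set" where
  "residue_classes p = {0..<int p}"

definition three_aps :: "nat \<Rightarrow> int set \<Rightarrow> (int \<times> int \<times> int) set" where
  "three_aps p S = {(x, y, z). x \<in> S \<and> y \<in> S \<and> z \<in> S \<and>
     (\<exists>n m :: int. x = n mod int p \<and> y = (n + m) mod int p \<and> z = (n + 2 * m) mod int p)}"

lemma three_aps_altdef:
  assumes "S \<subseteq> residue_classes p"
  shows "three_aps p S = {(x, y, z). x \<in> S \<and> y \<in> S \<and> z \<in> S \<and> [x + z = 2 * y] (mod int p)}"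
proof -
  have "(\<exists>n m :: int. x = n mod int p \<and> y = (n + m) mod int p \<and> z = (n + 2 * m) mod int p)
        \<longleftrightarrow> [x + z = 2 * y] (mod int p)" (is "?L \<longleftrightarrow> ?R")
    if "x \<in> S" "y \<in> S" "z \<in> S" for x y z
  proof
    assume ?L
    then obtain n m where xyz: "x = n mod int p" "y = (n + m) mod int p" "z = (n + 2 * m) mod int p"
      by blast
    have "(x + z) mod int p = (n + (n + 2 * m)) mod int p"
      unfolding xyz by (rule mod_add_eq)
    moreover have "(2 * y) mod int p = (2 * (n + m)) mod int p"
      unfolding xyz by (rule mod_mult_right_eq)
    ultimately show ?R by (simp add: cong_def algebra_simps)
  next
    assume ?R
    have range: "x mod int p = x" "y mod int p = y" "z mod int p = z"
      using that assms by (auto simp: residue_classes_def)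
    from \<open>?R\<close> have "[x + z - x = 2 * y - x] (mod int p)"
      by (intro cong_diff cong_refl)
    then have "z mod int p = (x + 2 * (y - x)) mod int p"
      by (simp add: cong_def algebra_simps)
    then show ?L
      using range by (intro exI[of _ x] exI[of _ "y - x"]) simp
  qed
  then show ?thesis unfolding three_aps_def by (simp cong: conj_cong)
qed

definition critical_set :: "nat \<Rightarrow> real \<Rightarrow> int set \<Rightarrow> bool" where
  "critical_set p d S \<longleftrightarrow>
     S \<subseteq> residue_classes p \<and> real (card S) \<ge> d * real p \<and>
     (\<forall>T. T \<subseteq> residue_classes p \<and> real (card T) \<ge> d * real p
        \<longrightarrow> card (three_aps p S) \<le> card (three_aps p T))"

text \<open>
  The condition \<open>card N = l\<close> says that the \<open>l\<close> terms are distinct. Without it, the common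
  difference \<open>0\<close> or wrapping around modulo \<open>p\<close> would give progressions of arbitrary length.
\<close>

definition is_ap_mod :: "nat \<Rightarrow> nat \<Rightarrow> int set \<Rightarrow> bool" where
  "is_ap_mod p l N \<longleftrightarrow>
     card N = l \<and> (\<exists>a b :: int. N = (\<lambda>j. (a + int j * b) mod int p) ` {..<l})"

end

theory Submission
  imports Defs "HOL-Library.FuncSet" "HOL-Real_Asymp.Real_Asymp"
begin

text \<open>
  Averaging a critical set \<open>S\<close> over a progression \<open>0, b, \<dots>, (l - 1) b\<close>, where \<open>b\<close> lies in the
  Bohr set of the large Fourier coefficients of \<open>S\<close>, gives a function \<open>g\<close> of the same mean and
  nearly the same number of progressions. Suppose that \<open>g \<le> 1 - x\<close> everywhere. Multiply \<open>g\<close> by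
  \<open>1 / (1 - x)\<close> times the indicator of a random affine image of the complement of an interval of
  density \<open>x\<close>. This essentially keeps the mean. As an interval of density \<open>x\<close> contains of the
  order of \<open>x\<^sup>2 p\<^sup>2\<close> progressions rather than \<open>x\<^sup>3 p\<^sup>2\<close>, the number of progressions drops by a
  factor \<open>1 - c x\<^sup>2\<close>. Rounding the result to a set contradicts criticality once \<open>x\<^sup>2\<close> exceeds a
  constant multiple of the smoothing error \<open>\<delta>\<close>; here Varnavides' theorem bounds the number of
  progressions from below. By Dirichlet's pigeonhole argument
  \<open>\<delta> = (ln p) powr (- 1 / 2 + o(1))\<close> is possible, so that \<open>x = (ln p) powr (- 1 / 4 + o(1))\<close>.
\<close>

text \<open>For a weight of given mean, every term in the expanded count of its complement except
  the cubic one depends on the mean alone. So a complement has the fewer progressions, the more the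
  removed set has, and an interval is taken because it is rich in them. One fixed interval need not
  affect \<open>g\<close> at all; a random affine image makes the count factor into that of
  \<open>g\<close> and that of the complement. This holds for non-trivial progressions only, whence
  \<open>ap_sum_nt\<close>; the \<open>p\<close> trivial ones are negligible against
  \<open>p^2\<close>. The mean is kept only on average, so the weight overshoots by a factor
  \<open>1 + \<tau>\<close>, and Chebyshev's inequality discards the images that fall short.

  The exponent 1/2: at most \<open>1 / \<delta>\<^sup>2\<close> Fourier coefficients are large, and
  pigeonholing with \<open>M\<close> (about \<open>l / \<delta>\<close>) arcs per frequency needs
  \<open>ln M / \<delta>\<^sup>2 < ln p\<close>. The length \<open>l\<close> enters only through
  \<open>ln M\<close>, so any power of \<open>ln p\<close> is admissible, and the lost
  \<open>ln (ln p)\<close> disappears in the o(1). A progression inside \<open>S\<close> results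
  from cutting the dense one into blocks of somewhat fewer than \<open>1 / x\<close> terms: there
  are more blocks than missing points.\<close>

section \<open>Periodic functions and their sums over a period\<close>

text \<open>Functions on the residue classes are encoded as functions on all integers, so that
  arguments such as \<open>n + 2 * m\<close> need no reduction.\<close>

definition periodic :: "nat \<Rightarrow> (int \<Rightarrow> 'a) \<Rightarrow> bool" where
  "periodic p f \<longleftrightarrow> (\<forall>n. f (n mod int p) = f n)"

lemma periodicD: "periodic p f \<Longrightarrow> f (n mod int p) = f n"
  by (simp add: periodic_def)

lemma periodic_cong:
  assumes "periodic p f" "[m = n] (mod int p)"
  shows "f m = f n"
proof -
  have "f (m mod int p) = f (n mod int p)"
    using assms(2) by (simp add: unique_euclidean_semiring_class.cong_def)
  then show ?thesis by (simp only: periodicD[OF assms(1)])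
qed

lemma periodicI: "(\<And>m n. [m = n] (mod int p) \<Longrightarrow> f m = f n) \<Longrightarrow> periodic p f"
  by (simp add: periodic_def)

lemma finite_residue_classes [simp]: "finite (residue_classes p)"
  by (simp add: residue_classes_def)

lemma card_residue_classes [simp]: "card (residue_classes p) = p"
  by (simp add: residue_classes_def)

lemma mod_in_residue_classes [simp]: "p > 0 \<Longrightarrow> n mod int p \<in> residue_classes p"
  by (simp add: residue_classes_def)

lemma residue_classes_mod: "n \<in> residue_classes p \<Longrightarrow> n mod int p = n"
  by (simp add: residue_classes_def)

lemma residue_classes_cong_imp_eq:
  assumes "m \<in> residue_classes p" "n \<in> residue_classes p" "[m = n] (mod int p)"
  shows "m = n"
proof -
  have "m mod int p = n mod int p"
    using assms(3) by (simp add: unique_euclidean_semiring_class.cong_def)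
  then show ?thesis by (simp only: residue_classes_mod assms)
qed

lemma bij_betw_affine_residue_classes:
  assumes p: "p > 0" and u: "coprime u (int p)"
  shows "bij_betw (\<lambda>n. (u * n + v) mod int p) (residue_classes p) (residue_classes p)"
proof -
  have "inj_on (\<lambda>n. (u * n + v) mod int p) (residue_classes p)"
  proof (rule inj_onI)
    fix m n assume mn: "m \<in> residue_classes p" "n \<in> residue_classes p"
      and eq: "(u * m + v) mod int p = (u * n + v) mod int p"
    from eq have "[u * m = u * n] (mod int p)"
      by (simp add: cong_add_rcancel flip: unique_euclidean_semiring_class.cong_def)
    then have "[m = n] (mod int p)"
      using u by (simp add: cong_mult_lcancel)
    with mn show "m = n" by (rule residue_classes_cong_imp_eq)
  qed
  moreover have "(\<lambda>n. (u * n + v) mod int p) ` residue_classes p \<subseteq> residue_classes p"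
    using p by auto
  ultimately show ?thesis
    by (metis bij_betw_def endo_inj_surj finite_residue_classes)
qed

lemma sum_affine:
  fixes f :: "int \<Rightarrow> 'a::comm_monoid_add"
  assumes "p > 0" "periodic p f" "coprime u (int p)"
  shows "(\<Sum>n\<in>residue_classes p. f (u * n + v)) = (\<Sum>n\<in>residue_classes p. f n)"
proof -
  have "(\<Sum>n\<in>residue_classes p. f (u * n + v)) = (\<Sum>n\<in>residue_classes p. f ((u * n + v) mod int p))"
    using assms(2) by (simp add: periodicD)
  also have "\<dots> = (\<Sum>n\<in>residue_classes p. f n)"
    by (rule sum.reindex_bij_betw[OF bij_betw_affine_residue_classes[OF assms(1,3)]])
  finally show ?thesis .
qed

lemma sum_shift:
  fixes f :: "int \<Rightarrow> 'a::comm_monoid_add"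
  assumes "p > 0" "periodic p f"
  shows "(\<Sum>n\<in>residue_classes p. f (n + v)) = (\<Sum>n\<in>residue_classes p. f n)"
  using sum_affine[OF assms, of 1 v] by simp

section \<open>Fourier analysis on residue classes\<close>

definition character :: "nat \<Rightarrow> int \<Rightarrow> complex" where
  "character p x = cis (2 * pi * of_int x / of_nat p)"

lemma character_add: "character p (x + y) = character p x * character p y"
  by (simp add: character_def cis_mult distrib_left add_divide_distrib)

lemma character_0 [simp]: "character p 0 = 1"
  by (simp add: character_def)

lemma norm_character [simp]: "norm (character p x) = 1"
  by (simp add: character_def)

lemma cnj_character: "cnj (character p x) = character p (- x)"
  by (simp add: character_def cis_cnj)

lemma character_eq_1_iff:
  assumes "p > 0"
  shows "character p x = 1 \<longleftrightarrow> int p dvd x"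
proof
  assume "character p x = 1"
  then have "cos (2 * pi * of_int x / of_nat p) = 1"
    by (simp add: character_def cis.code complex_eq_iff)
  then obtain k :: int where "2 * pi * of_int x / of_nat p = of_int k * 2 * pi"
    by (auto simp: cos_one_2pi_int)
  then have "of_int x = (of_int (k * int p) :: real)"
    using assms by (simp add: field_simps)
  then show "int p dvd x" by (metis dvd_triv_right of_int_eq_iff)
next
  assume "int p dvd x"
  then obtain k where "x = int p * k" by blast
  then have "2 * pi * of_int x / of_nat p = 2 * pi * of_int k"
    using assms by simp
  then show "character p x = 1"
    unfolding character_def by (metis cis_multiple_2pi Ints_of_int)
qed

lemma character_cong:
  assumes "p > 0" "[x = y] (mod int p)"
  shows "character p x = character p y"
proof -
  have "character p (x - y) = 1"
    using assms by (simp add: character_eq_1_iff cong_iff_dvd_diff)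
  then show ?thesis using character_add[of p "x - y" y] by simp
qed

text \<open>Orthogonality: shifting the summation variable by 1 multiplies the sum by
  \<open>character p k\<close>, so the sum vanishes unless this factor is 1.\<close>

lemma sum_character:
  assumes p: "p > 0"
  shows "(\<Sum>a\<in>residue_classes p. character p (a * k)) = (if int p dvd k then of_nat p else 0)"
proof (cases "int p dvd k")
  case True
  then have "character p (a * k) = 1" for a
    using p by (simp add: character_eq_1_iff)
  with True show ?thesis by simp
next
  case False
  let ?s = "\<Sum>a\<in>residue_classes p. character p (a * k)"
  have "periodic p (\<lambda>a. character p (a * k))"
    by (intro periodicI character_cong[OF p] cong_scalar_right)
  from sum_shift[OF p this, of 1] have "?s = (\<Sum>a\<in>residue_classes p. character p (a * k + k))"
    by (simp add: distrib_right)
  also have "\<dots> = character p k * ?s"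
    by (simp add: character_add sum_distrib_left mult.commute)
  finally have "?s = character p k * ?s" .
  then have "?s = 0 \<or> character p k = 1" by auto
  then show ?thesis using False p by (simp add: character_eq_1_iff)
qed

text \<open>The transform is unnormalised: for \<open>f\<close> with values in [0, 1] its natural
  size is \<open>p\<close>, hence the thresholds \<open>\<eta> * real p\<close> below.\<close>

definition dft :: "nat \<Rightarrow> (int \<Rightarrow> real) \<Rightarrow> int \<Rightarrow> complex" where
  "dft p f a = (\<Sum>n\<in>residue_classes p. of_real (f n) * character p (- (a * n)))"

lemma periodic_dft: "p > 0 \<Longrightarrow> periodic p (dft p f)"
  unfolding dft_def
  by (intro periodicI sum.cong refl arg_cong2[where f = "(*)"] character_cong)
     (auto simp: cong_minus_minus_iff intro: cong_scalar_right)

text \<open>Parseval's identity: after expanding the square, orthogonality leaves only the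
  diagonal.\<close>

lemma sum_norm_dft_square:
  assumes p: "p > 0"
  shows "(\<Sum>a\<in>residue_classes p. (norm (dft p f a))\<^sup>2) = real p * (\<Sum>n\<in>residue_classes p. (f n)\<^sup>2)"
proof -
  let ?Z = "residue_classes p"
  have sq: "of_real ((norm (dft p f a))\<^sup>2) =
      (\<Sum>m\<in>?Z. \<Sum>n\<in>?Z. of_real (f m * f n) * character p (a * (n - m)))" for a
  proof -
    have "of_real (f m) * character p (- (a * m)) * (of_real (f n) * character p (a * n)) =
        of_real (f m * f n) * character p (a * (n - m))" for m n
      using character_add[of p "- (a * m)" "a * n"] by (simp add: algebra_simps)
    then show ?thesis
      unfolding complex_norm_square dft_def cnj_sum complex_cnj_mult complex_cnj_complex_of_real
        cnj_character minus_minus sum_product by (simp only:)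
  qed
  have "of_real (\<Sum>a\<in>?Z. (norm (dft p f a))\<^sup>2) =
      (\<Sum>a\<in>?Z. \<Sum>m\<in>?Z. \<Sum>n\<in>?Z. of_real (f m * f n) * character p (a * (n - m)))"
    unfolding of_real_sum sq ..
  also have "\<dots> = (\<Sum>m\<in>?Z. \<Sum>n\<in>?Z. \<Sum>a\<in>?Z. of_real (f m * f n) * character p (a * (n - m)))"
    by (subst sum.swap, rule sum.cong[OF refl], rule sum.swap)
  also have "\<dots> = (\<Sum>m\<in>?Z. \<Sum>n\<in>?Z. if n = m then of_nat p * of_real (f m * f n) else 0)"
  proof (intro sum.cong refl)
    fix m n assume mn: "m \<in> ?Z" "n \<in> ?Z"
    then have "int p dvd n - m \<longleftrightarrow> n = m"
      using residue_classes_cong_imp_eq[of n p m] by (auto simp: cong_iff_dvd_diff)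
    then show "(\<Sum>a\<in>?Z. of_real (f m * f n) * character p (a * (n - m))) =
        (if n = m then of_nat p * of_real (f m * f n) else 0)"
      using sum_character[OF p, of "n - m"] by (auto simp flip: sum_distrib_left)
  qed
  also have "\<dots> = of_real (real p * (\<Sum>n\<in>?Z. (f n)\<^sup>2))"
    by (simp add: sum.delta sum_distrib_left power2_eq_square)
  finally show ?thesis by (simp only: of_real_eq_iff)
qed

definition ap_sum :: "nat \<Rightarrow> (int \<Rightarrow> real) \<Rightarrow> real" where
  "ap_sum p f = (\<Sum>n\<in>residue_classes p. \<Sum>m\<in>residue_classes p. f n * f (n + m) * f (n + 2 * m))"

text \<open>Orthogonality in \<open>a\<close> detects \<open>x + z = 2 * y\<close>; the frequency
  \<open>- 2 * a\<close> belongs to the middle term \<open>y\<close>. The substitution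
  \<open>y = x + m\<close> then returns to start and difference.\<close>

lemma ap_sum_eq_dft:
  assumes p: "p > 0" and f: "periodic p f"
  shows "of_nat p * of_real (ap_sum p f) = (\<Sum>a\<in>residue_classes p. (dft p f a)\<^sup>2 * dft p f (- 2 * a))"
proof -
  let ?Z = "residue_classes p"
  have cube: "(dft p f a)\<^sup>2 * dft p f (- 2 * a) =
      (\<Sum>x\<in>?Z. \<Sum>y\<in>?Z. \<Sum>z\<in>?Z. of_real (f x * f y * f z) * character p (a * (2 * y - x - z)))" for a
  proof -
    have "(dft p f a)\<^sup>2 * dft p f (- 2 * a) = dft p f a * (dft p f (- 2 * a) * dft p f a)"
      by (simp add: power2_eq_square)
    also have "\<dots> = (\<Sum>x\<in>?Z. \<Sum>y\<in>?Z. \<Sum>z\<in>?Z. 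
       (of_real (f x) * character p (- (a * x))) * ((of_real (f y) * character p (- (- 2 * a * y))) *
       (of_real (f z) * character p (- (a * z)))))"
      unfolding dft_def sum_product by (simp add: sum_distrib_left)
    also have "\<dots> = (\<Sum>x\<in>?Z. \<Sum>y\<in>?Z. \<Sum>z\<in>?Z. of_real (f x * f y * f z) * character p (a * (2 * y - x - z)))"
    proof (intro sum.cong refl)
      fix x y z
      have "a * (2 * y - x - z) = - (a * x) + (- (- 2 * a * y) + - (a * z))"
        by (simp add: algebra_simps)
      then show "(of_real (f x) * character p (- (a * x))) * ((of_real (f y) * character p (- (- 2 * a * y))) *
       (of_real (f z) * character p (- (a * z)))) = of_real (f x * f y * f z) * character p (a * (2 * y - x - z))"
        by (simp only: character_add of_real_mult mult_ac)
    qed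
    finally show ?thesis .
  qed
  have "(\<Sum>a\<in>?Z. (dft p f a)\<^sup>2 * dft p f (- 2 * a)) =
     (\<Sum>x\<in>?Z. \<Sum>y\<in>?Z. \<Sum>z\<in>?Z. \<Sum>a\<in>?Z. of_real (f x * f y * f z) * character p (a * (2 * y - x - z)))"
    unfolding cube by (subst sum.swap, rule sum.cong[OF refl], subst sum.swap,
        rule sum.cong[OF refl], rule sum.swap)
  also have "\<dots> = (\<Sum>x\<in>?Z. \<Sum>y\<in>?Z. \<Sum>z\<in>?Z. 
      if z = (2 * y - x) mod int p then of_nat p * of_real (f x * f y * f z) else 0)"
  proof (intro sum.cong refl)
    fix x y z assume z: "z \<in> ?Z"
    have "int p dvd 2 * y - x - z \<longleftrightarrow> z = (2 * y - x) mod int p"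
      using z residue_classes_mod[OF z] by (simp add: mod_eq_dvd_iff[symmetric] eq_commute)
    then show "(\<Sum>a\<in>?Z. of_real (f x * f y * f z) * character p (a * (2 * y - x - z))) =
       (if z = (2 * y - x) mod int p then of_nat p * of_real (f x * f y * f z) else 0)"
      using sum_character[OF p, of "2 * y - x - z"] by (auto simp flip: sum_distrib_left)
  qed
  also have "\<dots> = (\<Sum>x\<in>?Z. of_nat p * of_real (\<Sum>y\<in>?Z. f x * f y * f (2 * y - x)))"
    using p f by (simp add: sum.delta periodicD sum_distrib_left)
  also have "\<dots> = (\<Sum>x\<in>?Z. of_nat p * of_real (\<Sum>m\<in>?Z. f x * f (x + m) * f (x + 2 * m)))"
  proof -
    have "(\<Sum>y\<in>?Z. f x * f y * f (2 * y - x)) = (\<Sum>m\<in>?Z. f x * f (x + m) * f (x + 2 * m))" for x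
    proof -
      have "periodic p (\<lambda>y. f x * f y * f (2 * y - x))"
        by (intro periodicI arg_cong2[where f = "(*)"] refl periodic_cong[OF f] cong_diff
            cong_scalar_left cong_refl) auto
      from sum_shift[OF p this, of x] show ?thesis
        by (simp add: algebra_simps)
    qed
    then show ?thesis by (simp only:)
  qed
  also have "\<dots> = of_nat p * of_real (ap_sum p f)"
    unfolding ap_sum_def by (simp add: sum_distrib_left)
  finally show ?thesis ..
qed

section \<open>Averaging over progressions and Bohr sets\<close>

text \<open>For an indicator function the value at \<open>n\<close> is the proportion of the
  \<open>l\<close> terms starting at \<open>n\<close> that lie in the set. A value near 1 is
  therefore the dense progression sought.\<close>

definition smooth :: "int \<Rightarrow> nat \<Rightarrow> (int \<Rightarrow> real) \<Rightarrow> int \<Rightarrow> real" where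
  "smooth b l f n = (\<Sum>j<l. f (n + int j * b)) / real l"

lemma periodic_smooth: "periodic p f \<Longrightarrow> periodic p (smooth b l f)"
  unfolding smooth_def
  by (intro periodicI arg_cong2[where f = "(/)"] refl sum.cong)
     (auto intro!: periodic_cong[of p f] cong_add)

lemma sum_smooth:
  assumes "p > 0" "periodic p f" "l > 0"
  shows "(\<Sum>n\<in>residue_classes p. smooth b l f n) = (\<Sum>n\<in>residue_classes p. f n)"
proof -
  have "(\<Sum>n\<in>residue_classes p. smooth b l f n) =
      (\<Sum>j<l. \<Sum>n\<in>residue_classes p. f (n + int j * b)) / real l"
    unfolding smooth_def by (simp add: sum.swap[of _ "residue_classes p"] flip: sum_divide_distrib)
  also have "\<dots> = (\<Sum>n\<in>residue_classes p. f n)"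
    using assms by (simp add: sum_shift)
  finally show ?thesis .
qed

lemma dft_shift:
  assumes "p > 0" "periodic p f"
  shows "dft p (\<lambda>n. f (n + k)) a = character p (a * k) * dft p f a"
proof -
  have "periodic p (\<lambda>n. of_real (f n) * character p (- (a * (n - k))))"
  proof (rule periodicI)
    fix m n assume mn: "[m = n] (mod int p)"
    then have "[- (a * (m - k)) = - (a * (n - k))] (mod int p)"
      by (intro cong_minus_minus_iff[THEN iffD2] cong_scalar_left cong_diff cong_refl)
    then show "of_real (f m) * character p (- (a * (m - k))) =
        of_real (f n) * character p (- (a * (n - k)))"
      by (simp only: periodic_cong[OF assms(2) mn] character_cong[OF assms(1)])
  qed
  from sum_shift[OF assms(1) this, of k]
  have "dft p (\<lambda>n. f (n + k)) a = (\<Sum>n\<in>residue_classes p. of_real (f n) * character p (- (a * (n - k))))"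
    by (simp add: dft_def)
  also have "\<dots> = (\<Sum>n\<in>residue_classes p. character p (a * k) * (of_real (f n) * character p (- (a * n))))"
  proof (rule sum.cong[OF refl])
    fix n
    have "character p (- (a * (n - k))) = character p (a * k) * character p (- (a * n))"
      using character_add[of p "a * k" "- (a * n)"] by (simp add: algebra_simps)
    then show "of_real (f n) * character p (- (a * (n - k))) =
        character p (a * k) * (of_real (f n) * character p (- (a * n)))"
      by simp
  qed
  finally show ?thesis
    by (simp add: dft_def sum_distrib_left)
qed

text \<open>Averaging is a Fourier multiplier. It is close to 1 at the frequencies whose Bohr set
  contains \<open>b\<close>.\<close>

lemma dft_smooth:
  assumes "p > 0" "periodic p f"
  shows "dft p (smooth b l f) a = (\<Sum>j<l. character p (a * (int j * b))) / of_nat l * dft p f a"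
proof -
  have "dft p (smooth b l f) a = (\<Sum>j<l. dft p (\<lambda>n. f (n + int j * b)) a) / of_nat l"
    unfolding dft_def smooth_def
    by (simp add: sum.swap[of _ "residue_classes p"] sum_distrib_right flip: sum_divide_distrib)
  then show ?thesis
    using assms by (simp add: dft_shift flip: sum_distrib_right)
qed

text \<open>A Bohr condition on \<open>b\<close> alone thus controls all multiples
  \<open>j * b\<close> with \<open>j < l\<close>, which is why the condition has radius
  \<open>\<delta> / l\<close>.\<close>

lemma norm_1_minus_character_mult:
  "norm (1 - character p (int k * x)) \<le> real k * norm (1 - character p x)"
proof (induction k)
  case (Suc k)
  have "1 - character p (int (Suc k) * x) =
      (1 - character p x) + character p x * (1 - character p (int k * x))"
    using character_add[of p x "int k * x"] by (simp add: algebra_simps)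
  also have "norm \<dots> \<le> norm (1 - character p x) + norm (1 - character p (int k * x))"
    by (rule norm_triangle_le) (simp add: norm_mult)
  finally show ?case using Suc by (simp add: algebra_simps)
qed simp

lemma norm_1_minus_character_minus: "norm (1 - character p (- x)) = norm (1 - character p x)"
  by (metis cnj_character complex_cnj_diff complex_cnj_one complex_mod_cnj)

text \<open>Used with \<open>c\<close> and \<open>d\<close> the multipliers at \<open>a\<close> and
  \<open>- 2 * a\<close>; their product is what smoothing puts in front of a summand of
  \<open>ap_sum_eq_dft\<close>.\<close>

lemma norm_1_minus_mult:
  fixes c d :: complex
  assumes "norm c \<le> 1"
  shows "norm (1 - c\<^sup>2 * d) \<le> 2 * norm (1 - c) + norm (1 - d)"
proof -
  have "1 - c\<^sup>2 * d = (1 - c) + c * (1 - c) + c\<^sup>2 * (1 - d)"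
    by (simp add: algebra_simps power2_eq_square)
  also have "norm \<dots> \<le> norm (1 - c) + norm (c * (1 - c)) + norm (c\<^sup>2 * (1 - d))"
    by (meson norm_add_leD norm_triangle_le norm_triangle_mono order_refl norm_triangle_ineq)
  also have "norm (c * (1 - c)) \<le> norm (1 - c)"
    using assms by (simp add: norm_mult mult_left_le_one_le)
  also have "norm (c\<^sup>2 * (1 - d)) \<le> norm (1 - d)"
    using assms by (simp add: norm_mult norm_power mult_left_le_one_le power_le_one)
  finally show ?thesis by simp
qed

lemma norm_dft_le:
  assumes "\<And>n. 0 \<le> f n" "\<And>n. f n \<le> 1"
  shows "norm (dft p f a) \<le> real p"
proof -
  have "norm (dft p f a) \<le> (\<Sum>n\<in>residue_classes p. 1)"
    unfolding dft_def using assms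
    by (intro sum_norm_le) (simp add: norm_mult)
  then show ?thesis by simp
qed

lemma sum_norm_dft_square_le:
  assumes "p > 0" "\<And>n. 0 \<le> f n" "\<And>n. f n \<le> 1"
  shows "(\<Sum>a\<in>residue_classes p. (norm (dft p f a))\<^sup>2) \<le> (real p)\<^sup>2"
proof -
  have "(\<Sum>n\<in>residue_classes p. (f n)\<^sup>2) \<le> (\<Sum>n\<in>residue_classes p. 1)"
    using assms by (intro sum_mono) (simp add: power_le_one)
  then have "real p * (\<Sum>n\<in>residue_classes p. (f n)\<^sup>2) \<le> real p * real p"
    by (intro mult_left_mono) auto
  then show ?thesis
    unfolding sum_norm_dft_square[OF assms(1)] by (simp only: power2_eq_square)
qed

lemma norm_1_minus_average_le:
  assumes "l > 0" "\<And>j. j < l \<Longrightarrow> norm (1 - z j) \<le> (d::real)"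
  shows "norm (1 - (\<Sum>j<l. z j) / of_nat l :: complex) \<le> d"
proof -
  have "1 - (\<Sum>j<l. z j) / of_nat l = (\<Sum>j<l. 1 - z j) / of_nat l"
    using assms(1) by (simp add: sum_subtractf diff_divide_distrib)
  also have "norm \<dots> = norm (\<Sum>j<l. 1 - z j) / real l"
    by (simp add: norm_divide)
  also have "norm (\<Sum>j<l. 1 - z j) \<le> of_nat (card {..<l}) * d"
    using assms(2) by (intro sum_norm_bound) auto
  finally show ?thesis using assms(1) by (simp add: field_simps)
qed

text \<open>Frequencies with small Fourier coefficient contribute little to the number of
  progressions, and the others are hardly changed by averaging over a progression whose
  difference lies in their Bohr set.\<close>

lemma ap_sum_smooth_le:
  assumes p: "p > 0" "odd p" and f: "periodic p f" "\<And>n. 0 \<le> f n" "\<And>n. f n \<le> 1"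
    and l: "l > 0" and \<eta>: "0 \<le> \<eta>" and \<delta>: "0 \<le> \<delta>"
    and b: "\<And>a. a \<in> residue_classes p \<Longrightarrow> norm (dft p f a) > \<eta> * real p \<Longrightarrow>
        norm (1 - character p (a * b)) \<le> \<delta> / real l"
  shows "\<bar>ap_sum p f - ap_sum p (smooth b l f)\<bar> \<le> (4 * \<delta> + 2 * \<eta>) * (real p)\<^sup>2"
proof -
  let ?Z = "residue_classes p"
  define F where "F = dft p f"
  define c where "c a = (\<Sum>j<l. character p (a * (int j * b))) / of_nat l" for a
  have norm_c: "norm (c a) \<le> 1" for a
  proof -
    have "norm (\<Sum>j<l. character p (a * (int j * b))) \<le> of_nat (card {..<l}) * 1"
      by (intro sum_norm_bound) auto
    then show ?thesis using l by (simp add: c_def norm_divide)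
  qed
  have F_le: "norm (F a) \<le> real p" for a
    unfolding F_def by (rule norm_dft_le) (use f in auto)
  \<comment> \<open>One bound for both kinds of frequency: the first term pays for the large ones,
    the second for the small ones. Both are quadratic in the coefficients, so that Parseval can sum
    them.\<close>
  have summand_le: "norm ((F a)\<^sup>2 * F (- 2 * a) * (1 - (c a)\<^sup>2 * c (- 2 * a))) \<le>
      4 * \<delta> * real p * (norm (F a))\<^sup>2 + \<eta> * real p * ((norm (F a))\<^sup>2 + (norm (F (- 2 * a)))\<^sup>2)"
    if a: "a \<in> ?Z" for a
  proof (cases "norm (F a) > \<eta> * real p")
    case True
    then have ab: "norm (1 - character p (a * b)) \<le> \<delta> / real l"
      using b a by (simp add: F_def)
    \<comment> \<open>\<open>m = 1\<close> serves the multiples \<open>j < l\<close> at frequency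
      \<open>a\<close>, \<open>m = 2\<close> the multiples \<open>2 * j\<close> at frequency
      \<open>- 2 * a\<close>.\<close>
    have mult: "norm (1 - character p (int k * (a * b))) \<le> m * \<delta>"
      if "real k \<le> m * real l" for k m
    proof -
      have "norm (1 - character p (int k * (a * b))) \<le> real k * (\<delta> / real l)"
        by (rule order_trans[OF norm_1_minus_character_mult]) (intro mult_left_mono ab, simp)
      also have "\<dots> \<le> (m * real l) * (\<delta> / real l)"
        using \<delta> that by (intro mult_right_mono) auto
      finally show ?thesis using l by simp
    qed
    have "norm (1 - c a) \<le> \<delta>"
      unfolding c_def using mult[of _ 1]
      by (intro norm_1_minus_average_le[OF l]) (simp add: mult_ac)
    moreover have "norm (1 - c (- 2 * a)) \<le> 2 * \<delta>"
      unfolding c_def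
    proof (intro norm_1_minus_average_le[OF l])
      fix j assume "j < l"
      have "- 2 * a * (int j * b) = - (int (2 * j) * (a * b))" by simp
      then show "norm (1 - character p (- 2 * a * (int j * b))) \<le> 2 * \<delta>"
        using mult[of "2 * j" 2] \<open>j < l\<close> by (simp only: norm_1_minus_character_minus)
    qed
    ultimately have "norm (1 - (c a)\<^sup>2 * c (- 2 * a)) \<le> 4 * \<delta>"
      using norm_1_minus_mult[OF norm_c[of a], of "c (- 2 * a)"] by linarith
    then have "norm ((F a)\<^sup>2 * F (- 2 * a) * (1 - (c a)\<^sup>2 * c (- 2 * a))) \<le>
        (norm (F a))\<^sup>2 * real p * (4 * \<delta>)"
      unfolding norm_mult norm_power using F_le \<delta> by (intro mult_mono) auto
    moreover have "0 \<le> \<eta> * real p * ((norm (F a))\<^sup>2 + (norm (F (- 2 * a)))\<^sup>2)"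
      using \<eta> by simp
    ultimately show ?thesis by (simp add: mult_ac)
  next
    case False
    have "norm ((c a)\<^sup>2 * c (- 2 * a)) \<le> 1"
      using norm_c[of a] norm_c[of "- 2 * a"]
      by (simp add: norm_mult norm_power power_le_one mult_le_one)
    then have "norm (1 - (c a)\<^sup>2 * c (- 2 * a)) \<le> 2"
      by (intro norm_triangle_le_diff) simp
    then have "norm ((F a)\<^sup>2 * F (- 2 * a) * (1 - (c a)\<^sup>2 * c (- 2 * a))) \<le>
        (norm (F a) * (norm (F a) * norm (F (- 2 * a)))) * 2"
      unfolding norm_mult norm_power power2_eq_square mult.assoc
      by (intro mult_left_mono) auto
    \<comment> \<open>Only one of the three factors is replaced by the threshold; the other two are
      kept for the inequality between geometric and arithmetic mean.\<close>
    also have "\<dots> \<le> (\<eta> * real p) * (norm (F a) * norm (F (- 2 * a))) * 2"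
      using False by (intro mult_right_mono) auto
    also have "\<dots> = \<eta> * real p * (2 * norm (F a) * norm (F (- 2 * a)))"
      by simp
    also have "\<dots> \<le> \<eta> * real p * ((norm (F a))\<^sup>2 + (norm (F (- 2 * a)))\<^sup>2)"
      using \<eta> by (intro mult_left_mono sum_squares_bound) auto
    also have "0 \<le> 4 * \<delta> * real p * (norm (F a))\<^sup>2"
      using \<delta> by simp
    ultimately show ?thesis by linarith
  qed
  have "of_nat p * of_real (ap_sum p f - ap_sum p (smooth b l f)) =
      (\<Sum>a\<in>?Z. (F a)\<^sup>2 * F (- 2 * a)) - (\<Sum>a\<in>?Z. (c a * F a)\<^sup>2 * (c (- 2 * a) * F (- 2 * a)))"
    unfolding of_real_diff right_diff_distrib ap_sum_eq_dft[OF p(1) f(1)]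
      ap_sum_eq_dft[OF p(1) periodic_smooth[OF f(1)]] dft_smooth[OF p(1) f(1)] F_def c_def ..
  also have "\<dots> = (\<Sum>a\<in>?Z. (F a)\<^sup>2 * F (- 2 * a) * (1 - (c a)\<^sup>2 * c (- 2 * a)))"
    unfolding sum_subtractf[symmetric]
    by (intro sum.cong) (auto simp: algebra_simps power_mult_distrib)
  also have "norm \<dots> \<le> (\<Sum>a\<in>?Z. 4 * \<delta> * real p * (norm (F a))\<^sup>2 +
      \<eta> * real p * ((norm (F a))\<^sup>2 + (norm (F (- 2 * a)))\<^sup>2))"
    by (intro sum_norm_le summand_le)
  also have "\<dots> = 4 * \<delta> * real p * (\<Sum>a\<in>?Z. (norm (F a))\<^sup>2) +
      \<eta> * real p * ((\<Sum>a\<in>?Z. (norm (F a))\<^sup>2) + (\<Sum>a\<in>?Z. (norm (F (- 2 * a)))\<^sup>2))"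
    by (simp add: sum.distrib distrib_left flip: sum_distrib_left)
  \<comment> \<open>Multiplication by -2 permutes the residue classes because \<open>p\<close> is
    odd.\<close>
  also have "(\<Sum>a\<in>?Z. (norm (F (- 2 * a)))\<^sup>2) = (\<Sum>a\<in>?Z. (norm (F a))\<^sup>2)"
  proof -
    have "periodic p (\<lambda>a. (norm (F a))\<^sup>2)"
      using periodic_dft[OF p(1), of f] by (simp add: periodic_def F_def)
    moreover have "coprime (- 2) (int p)"
      using p(2) by simp
    ultimately show ?thesis
      using sum_affine[OF p(1), of _ "- 2" 0] by simp
  qed
  also have "4 * \<delta> * real p * (\<Sum>a\<in>?Z. (norm (F a))\<^sup>2) +
      \<eta> * real p * ((\<Sum>a\<in>?Z. (norm (F a))\<^sup>2) + (\<Sum>a\<in>?Z. (norm (F a))\<^sup>2)) =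
      (4 * \<delta> + 2 * \<eta>) * real p * (\<Sum>a\<in>?Z. (norm (F a))\<^sup>2)"
    by (simp add: algebra_simps)
  also have "\<dots> \<le> (4 * \<delta> + 2 * \<eta>) * real p * (real p)\<^sup>2"
    unfolding F_def using \<delta> \<eta> f
    by (intro mult_left_mono sum_norm_dft_square_le p) auto
  finally have "real p * \<bar>ap_sum p f - ap_sum p (smooth b l f)\<bar> \<le>
      real p * ((4 * \<delta> + 2 * \<eta>) * (real p)\<^sup>2)"
    by (simp add: norm_mult mult_ac flip: of_real_diff)
  then show ?thesis using p(1) by simp
qed

text \<open>Chebyshev's inequality applied to Parseval. That the bound does not involve
  \<open>p\<close> is what makes the Bohr sets below large.\<close>

lemma card_large_spectrum_le:
  assumes p: "p > 0" and f: "\<And>n. 0 \<le> f n" "\<And>n. f n \<le> 1" and \<eta>: "0 < \<eta>"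
  shows "real (card {a \<in> residue_classes p. norm (dft p f a) > \<eta> * real p}) \<le> 1 / \<eta>\<^sup>2"
proof -
  let ?R = "{a \<in> residue_classes p. norm (dft p f a) > \<eta> * real p}"
  have "real (card ?R) * (\<eta> * real p)\<^sup>2 \<le> (\<Sum>a\<in>?R. (norm (dft p f a))\<^sup>2)"
    using \<eta> by (intro sum_bounded_below power_mono) auto
  also have "\<dots> \<le> (\<Sum>a\<in>residue_classes p. (norm (dft p f a))\<^sup>2)"
    by (intro sum_mono2) auto
  also have "\<dots> \<le> (real p)\<^sup>2"
    by (rule sum_norm_dft_square_le) (use assms in auto)
  finally have "(real (card ?R) * \<eta>\<^sup>2) * (real p)\<^sup>2 \<le> 1 * (real p)\<^sup>2"
    by (simp add: power_mult_distrib mult_ac)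
  then have "real (card ?R) * \<eta>\<^sup>2 \<le> 1"
    using p by simp
  then show ?thesis using \<eta> by (simp add: field_simps)
qed

text \<open>A chord is at most as long as its arc; the chord is twice the absolute sine of half the
  angle.\<close>

lemma norm_1_minus_cis_le: "norm (1 - cis t) \<le> \<bar>t\<bar>"
proof -
  have "(norm (1 - cis t))\<^sup>2 = (1 - cos t)\<^sup>2 + (sin t)\<^sup>2"
    by (simp add: cmod_power2)
  also have "\<dots> = 2 - 2 * cos t"
    using sin_cos_squared_add[of t] by (simp add: power2_diff)
  also have "\<dots> = 4 * (sin (t / 2))\<^sup>2"
    using cos_double_sin[of "t / 2"] by simp
  also have "\<dots> \<le> 4 * (t / 2)\<^sup>2"
    using abs_sin_x_le_abs_x[of "t / 2"] by (simp only: mult_left_mono abs_le_square_iff)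
  finally show ?thesis
    by (simp add: power_divide abs_le_square_iff[symmetric] power2_le_iff_abs_le)
qed

lemma abs_diff_le_of_div_eq:
  fixes x y k :: int
  assumes "k > 0" "x div k = y div k"
  shows "\<bar>x - y\<bar> \<le> k"
proof -
  have "x - y = x mod k - y mod k"
    using assms(2) by (simp flip: minus_div_mult_eq_mod)
  then show ?thesis
    using pos_mod_sign[OF assms(1), of x] pos_mod_bound[OF assms(1), of x]
      pos_mod_sign[OF assms(1), of y] pos_mod_bound[OF assms(1), of y] by arith
qed

text \<open>Dirichlet's pigeonhole argument with \<open>M\<close> arcs for each frequency:
  differences of points in the same cell lie in the Bohr set. The counting form is needed for
  Varnavides' theorem, which uses many differences; the dense progression needs only one non-zero
  element.\<close>

lemma card_bohr_set_ge:
  assumes p: "p > 0" and R: "finite R" and M: "M > 0"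
  shows "p \<le> M ^ card R *
    card {b \<in> residue_classes p. \<forall>a\<in>R. norm (1 - character p (a * b)) \<le> 2 * pi / real M}"
proof -
  let ?Z = "residue_classes p"
  define B where "B = {b \<in> ?Z. \<forall>a\<in>R. norm (1 - character p (a * b)) \<le> 2 * pi / real M}"
  \<comment> \<open>For each frequency \<open>a\<close> in \<open>R\<close>, the index of the arc of
    length \<open>p / M\<close> that contains \<open>a * n\<close> modulo \<open>p\<close>.\<close>
  define cell where "cell n = restrict (\<lambda>a. (int M * ((a * n) mod int p)) div int p) R" for n
  let ?C = "R \<rightarrow>\<^sub>E {0..<int M}"
  have cell: "cell n \<in> ?C" for n
  proof -
    have "int M * (k mod int p) div int p < int M" for k
    proof -
      have "(int M * (k mod int p)) div int p * int p \<le> int M * (k mod int p)"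
        using p div_mult_mod_eq[of "int M * (k mod int p)" "int p"]
          pos_mod_sign[of "int p" "int M * (k mod int p)"] by linarith
      also have "\<dots> < int M * int p"
        using p M by (intro mult_strict_left_mono) auto
      finally show ?thesis using p by (simp only: mult_less_cancel_right)
    qed
    then show ?thesis using p by (auto simp: cell_def pos_imp_zdiv_nonneg_iff)
  qed
  \<comment> \<open>Subtracting a fixed point \<open>n0\<close> of the fibre embeds the fibre into
    the Bohr set.\<close>
  have fibre: "card {n \<in> ?Z. cell n = k} \<le> card B" for k
  proof (cases "{n \<in> ?Z. cell n = k} = {}")
    case False
    then obtain n0 where n0: "n0 \<in> ?Z" "cell n0 = k" by blast
    have "inj_on (\<lambda>n. (n - n0) mod int p) {n \<in> ?Z. cell n = k}"
    proof (rule inj_onI)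
      fix m n assume mn: "m \<in> {n \<in> ?Z. cell n = k}" "n \<in> {n \<in> ?Z. cell n = k}"
        and "(m - n0) mod int p = (n - n0) mod int p"
      then have "[m = n] (mod int p)"
        by (simp add: mod_eq_dvd_iff cong_iff_dvd_diff)
      with mn show "m = n" by (auto intro: residue_classes_cong_imp_eq)
    qed
    moreover have "(n - n0) mod int p \<in> B" if n: "n \<in> ?Z" "cell n = k" for n
    proof -
      have "norm (1 - character p (a * ((n - n0) mod int p))) \<le> 2 * pi / real M" if a: "a \<in> R" for a
      proof -
        let ?x = "(a * n) mod int p" and ?y = "(a * n0) mod int p"
        have "(int M * ?x) div int p = (int M * ?y) div int p"
          using n n0 a by (auto simp: cell_def dest: fun_cong[of _ _ a])
        then have "\<bar>int M * ?x - int M * ?y\<bar> \<le> int p"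
          using p by (intro abs_diff_le_of_div_eq) auto
        then have "\<bar>real_of_int (int M * ?x - int M * ?y)\<bar> \<le> real p"
          by linarith
        then have "real M * \<bar>of_int (?x - ?y)\<bar> \<le> real p"
          by (simp add: abs_mult flip: right_diff_distrib)
        then have xy: "\<bar>of_int (?x - ?y)\<bar> / real p \<le> 1 / real M"
          using p M by (simp add: field_simps)
        have "[a * ((n - n0) mod int p) = ?x - ?y] (mod int p)"
          unfolding unique_euclidean_semiring_class.cong_def by (simp add: mod_simps right_diff_distrib)
        then have "norm (1 - character p (a * ((n - n0) mod int p))) = norm (1 - character p (?x - ?y))"
          using character_cong[OF p] by simp
        also have "\<dots> \<le> \<bar>2 * pi * of_int (?x - ?y) / of_nat p\<bar>"
          unfolding character_def by (rule norm_1_minus_cis_le)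
        also have "\<dots> = 2 * pi * (\<bar>of_int (?x - ?y)\<bar> / real p)"
          by (simp add: abs_mult)
        also have "\<dots> \<le> 2 * pi * (1 / real M)"
          using xy by (intro mult_left_mono) auto
        finally show ?thesis by simp
      qed
      then show ?thesis using p by (simp add: B_def)
    qed
    ultimately show ?thesis
      by (intro card_inj_on_le[of "\<lambda>n. (n - n0) mod int p"]) (auto simp: B_def)
  next
    case True
    then show ?thesis by (simp only: card.empty)
  qed
  have "p = (\<Sum>n\<in>?Z. 1)" by simp
  also have "\<dots> = (\<Sum>k\<in>?C. \<Sum>n\<in>{n \<in> ?Z. cell n = k}. 1)"
    using cell R by (intro sum.group[symmetric] finite_PiE) auto
  also have "\<dots> = (\<Sum>k\<in>?C. card {n \<in> ?Z. cell n = k})" by simp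
  also have "\<dots> \<le> card ?C * card B"
    using sum_bounded_above[of ?C "\<lambda>k. card {n \<in> ?Z. cell n = k}" "card B"] fibre by simp
  also have "card ?C = M ^ card R"
    using R by (simp add: card_PiE)
  finally show ?thesis unfolding B_def .
qed

section \<open>Varnavides' theorem\<close>

definition indicator_mod :: "nat \<Rightarrow> int set \<Rightarrow> int \<Rightarrow> real" where
  "indicator_mod p S n = of_bool (n mod int p \<in> S)"

lemma periodic_indicator_mod: "periodic p (indicator_mod p S)"
  by (simp add: periodic_def indicator_mod_def)

lemma indicator_mod_nonneg [simp]: "0 \<le> indicator_mod p S n"
  and indicator_mod_le_1 [simp]: "indicator_mod p S n \<le> 1"
  by (simp_all add: indicator_mod_def)

lemma sum_indicator_mod:
  assumes "S \<subseteq> residue_classes p"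
  shows "(\<Sum>n\<in>residue_classes p. indicator_mod p S n) = real (card S)"
proof -
  have "(\<Sum>n\<in>residue_classes p. indicator_mod p S n) = (\<Sum>n\<in>residue_classes p. if n \<in> S then 1 else 0)"
    by (intro sum.cong) (auto simp: indicator_mod_def residue_classes_mod)
  also have "\<dots> = real (card (residue_classes p \<inter> S))"
    by (simp flip: sum.inter_restrict)
  finally show ?thesis using assms by (simp add: Int_absorb1)
qed

lemma ap_sum_mono:
  assumes "\<And>n. 0 \<le> f n" "\<And>n. f n \<le> g n"
  shows "ap_sum p f \<le> ap_sum p g"
  unfolding ap_sum_def using assms
  by (intro sum_mono mult_mono mult_nonneg_nonneg) (auto intro: order_trans)

text \<open>The first two terms of a triple determine start and difference modulo \<open>p\<close>,
  so no progression is counted twice.\<close>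

lemma card_three_aps_eq_ap_sum:
  assumes p: "p > 0" and S: "S \<subseteq> residue_classes p"
  shows "real (card (three_aps p S)) = ap_sum p (indicator_mod p S)"
proof -
  let ?Z = "residue_classes p"
  define Q where "Q = {(n, m). n \<in> ?Z \<and> m \<in> ?Z \<and>
      n mod int p \<in> S \<and> (n + m) mod int p \<in> S \<and> (n + 2 * m) mod int p \<in> S}"
  define \<phi> where "\<phi> = (\<lambda>(n, m). (n mod int p, (n + m) mod int p, (n + 2 * m) mod int p))"
  have "ap_sum p (indicator_mod p S) = (\<Sum>(n, m)\<in>?Z \<times> ?Z. if (n, m) \<in> Q then 1 else 0)"
    unfolding ap_sum_def sum.cartesian_product
    by (intro sum.cong) (auto simp: Q_def indicator_mod_def)
  also have "\<dots> = (\<Sum>x\<in>?Z \<times> ?Z. if x \<in> Q then 1 else 0)"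
    by (simp add: case_prod_unfold)
  also have "\<dots> = real (card (?Z \<times> ?Z \<inter> Q))"
    by (simp flip: sum.inter_restrict)
  also have "?Z \<times> ?Z \<inter> Q = Q"
    by (auto simp: Q_def)
  also have "card Q = card (three_aps p S)"
  proof (rule bij_betw_same_card[of \<phi>], rule bij_betw_imageI)
    show "inj_on \<phi> Q"
    proof (rule inj_onI, clarify)
      fix n m n' m' assume Q: "(n, m) \<in> Q" "(n', m') \<in> Q" and eq: "\<phi> (n, m) = \<phi> (n', m')"
      have n: "n = n'"
        using Q eq by (auto simp: Q_def \<phi>_def residue_classes_mod)
      have "[n + m = n + m'] (mod int p)"
        using eq n by (simp add: \<phi>_def unique_euclidean_semiring_class.cong_def)
      then have "[m = m'] (mod int p)"
        by (simp only: cong_add_lcancel)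
      then have "m = m'"
        using Q residue_classes_cong_imp_eq[of m p m'] by (simp add: Q_def)
      with n show "n = n' \<and> m = m'" by simp
    qed
    show "\<phi> ` Q = three_aps p S"
    proof
      show "\<phi> ` Q \<subseteq> three_aps p S"
        by (auto simp: \<phi>_def Q_def three_aps_def)
      show "three_aps p S \<subseteq> \<phi> ` Q"
      proof clarify
        fix x y z assume "(x, y, z) \<in> three_aps p S"
        then obtain n m where xyz: "x \<in> S" "y \<in> S" "z \<in> S" "x = n mod int p"
            "y = (n + m) mod int p" "z = (n + 2 * m) mod int p"
          by (auto simp: three_aps_def)
        have "[n mod int p + 2 * (m mod int p) = n + 2 * m] (mod int p)"
          by (intro cong_add cong_scalar_left) (simp_all add: unique_euclidean_semiring_class.cong_def)
        then have reduce: "(n mod int p + 2 * (m mod int p)) mod int p = (n + 2 * m) mod int p"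
          by (simp only: unique_euclidean_semiring_class.cong_def)
        have "\<phi> (n mod int p, m mod int p) = (x, y, z)"
          by (simp add: \<phi>_def xyz mod_add_eq reduce)
        moreover have "(n mod int p, m mod int p) \<in> Q"
          using xyz p by (simp add: Q_def mod_add_eq reduce)
        ultimately show "(x, y, z) \<in> \<phi> ` Q" by (metis image_eqI)
      qed
    qed
  qed
  finally show ?thesis by simp
qed

text \<open>For a difference \<open>b\<close> in the Bohr set of the large spectrum of \<open>S\<close>, the points \<open>n\<close> for which
  \<open>n\<close>, \<open>n + b\<close>, \<open>n + 2 b\<close> meet \<open>S\<close> form a set with few progressions, hence of density less
  than \<open>d\<close>. As the average of \<open>S\<close> over these triples is at least \<open>7 / 10 d\<close>, at least
  \<open>3 (7 / 10) d - 2 d\<close> of the triples must lie in \<open>S\<close>.\<close>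

lemma varnavides_step:
  fixes c d :: real
  assumes c: "c > 0" and d: "d > 0"
    and IH: "\<And>p S. odd p \<Longrightarrow> S \<subseteq> residue_classes p \<Longrightarrow> d * real p \<le> real (card S) \<Longrightarrow>
        c * (real p)\<^sup>2 \<le> ap_sum p (indicator_mod p S)"
  shows "\<exists>c'>0. \<forall>p S. odd p \<longrightarrow> S \<subseteq> residue_classes p \<longrightarrow> 7 / 10 * d * real p \<le> real (card S) \<longrightarrow>
        c' * (real p)\<^sup>2 \<le> ap_sum p (indicator_mod p S)"
proof -
  \<comment> \<open>These values make \<open>27 * (c' + 6 * \<delta>) < c\<close>, where 27 is the
    cube of the factor 3 in \<open>A_le\<close>. \<open>M\<close> gives Bohr radius
    \<open>\<delta> / 3\<close> for progressions of 3 terms, and \<open>K\<close> bounds the size of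
    the spectrum. The second bound in \<open>c'\<close> is what the at least
    \<open>p / M ^ K\<close> differences, with \<open>d * p / 10\<close> progressions each,
    provide.\<close>
  define \<delta> where "\<delta> = c / 500"
  define M where "M = nat \<lceil>6 * pi / \<delta>\<rceil>"
  define K where "K = nat \<lfloor>1 / \<delta>\<^sup>2\<rfloor>"
  define c' where "c' = min (c / 100) (d / (10 * real (M ^ K)))"
  have \<delta>: "\<delta> > 0" using c by (simp add: \<delta>_def)
  have M0: "M > 0" using \<delta> by (simp add: M_def)
  have "6 * pi / \<delta> \<le> real M"
    unfolding M_def by linarith
  then have M: "2 * pi / real M \<le> \<delta> / real 3"
    using M0 \<delta> by (simp add: field_simps)
  have "c' > 0" using c d M0 by (simp add: c'_def)
  moreover have "c' * (real p)\<^sup>2 \<le> ap_sum p (indicator_mod p S)"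
    if p: "odd p" and S: "S \<subseteq> residue_classes p" "7 / 10 * d * real p \<le> real (card S)" for p S
  proof (rule ccontr)
    let ?Z = "residue_classes p"
    define f where "f = indicator_mod p S"
    assume "\<not> c' * (real p)\<^sup>2 \<le> ap_sum p (indicator_mod p S)"
    then have small: "ap_sum p f < c' * (real p)\<^sup>2" by (simp add: f_def)
    have p0: "p > 0" using p by (simp add: odd_pos)
    have f: "periodic p f" "\<And>n. 0 \<le> f n" "\<And>n. f n \<le> 1"
      by (simp_all add: f_def periodic_indicator_mod)
    define R where "R = {a \<in> ?Z. norm (dft p f a) > \<delta> * real p}"
    define B where "B = {b \<in> ?Z. \<forall>a\<in>R. norm (1 - character p (a * b)) \<le> 2 * pi / real M}"
    have "real (card R) \<le> 1 / \<delta>\<^sup>2"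
      unfolding R_def by (rule card_large_spectrum_le[OF p0 f(2,3) \<delta>])
    then have "card R \<le> K" unfolding K_def by (simp add: le_nat_floor)
    then have "M ^ card R \<le> M ^ K" using M0 by (intro power_increasing) auto
    then have "M ^ card R * card B \<le> M ^ K * card B" by simp
    moreover have "p \<le> M ^ card R * card B"
      unfolding B_def by (rule card_bohr_set_ge[OF p0 _ M0]) (simp add: R_def)
    ultimately have cardB: "real p \<le> real (M ^ K) * real (card B)"
      by (metis le_trans of_nat_le_iff of_nat_mult)
    have G: "d * real p / 10 \<le> (\<Sum>n\<in>?Z. f n * f (n + b) * f (n + 2 * b))" if b: "b \<in> B" for b
    proof -
      define g where "g = smooth b 3 f"
      define A where "A = {n \<in> ?Z. g n \<noteq> 0}"
      have g: "g n = (f n + f (n + b) + f (n + 2 * b)) / 3" for n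
        by (simp add: g_def smooth_def numeral_3_eq_3 numeral_2_eq_2)
      have gper: "periodic p g" unfolding g_def by (rule periodic_smooth[OF f(1)])
      have fcases: "f n = 0 \<or> f n = 1" for n by (simp add: f_def indicator_mod_def)
      \<comment> \<open>A non-zero value of \<open>g\<close> is at least 1/3.\<close>
      have A_le: "indicator_mod p A n \<le> 3 * g n" for n
      proof -
        have "g (n mod int p) = g n" by (rule periodicD[OF gper])
        then show ?thesis
          using fcases[of n] fcases[of "n + b"] fcases[of "n + 2 * b"]
          by (auto simp: A_def g indicator_mod_def)
      qed
      have "\<bar>ap_sum p f - ap_sum p g\<bar> \<le> (4 * \<delta> + 2 * \<delta>) * (real p)\<^sup>2"
        unfolding g_def
      proof (rule ap_sum_smooth_le[OF p0 p f])
        fix a assume "a \<in> ?Z" "norm (dft p f a) > \<delta> * real p"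
        then have "a \<in> R" by (simp add: R_def)
        then have "norm (1 - character p (a * b)) \<le> 2 * pi / real M"
          using b by (simp add: B_def)
        then show "norm (1 - character p (a * b)) \<le> \<delta> / real 3"
          using M by linarith
      qed (use \<delta> in auto)
      moreover have "ap_sum p (indicator_mod p A) \<le> ap_sum p (\<lambda>n. 3 * g n)"
        using A_le by (intro ap_sum_mono) auto
      moreover have "ap_sum p (\<lambda>n. 3 * g n) = 27 * ap_sum p g"
        by (simp add: ap_sum_def sum_distrib_left mult_ac)
      ultimately have "ap_sum p (indicator_mod p A) \<le> 27 * (c' * (real p)\<^sup>2 + 6 * \<delta> * (real p)\<^sup>2)"
        using small by (simp add: algebra_simps)
      also have "\<dots> = 27 * (c' + 6 * \<delta>) * (real p)\<^sup>2"
        by (simp add: algebra_simps)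
      also have "\<dots> < c * (real p)\<^sup>2"
      proof (rule mult_strict_right_mono)
        have "c' \<le> c / 100" by (simp add: c'_def)
        then show "27 * (c' + 6 * \<delta>) < c" using c by (simp add: \<delta>_def)
      qed (use p0 in simp)
      finally have "real (card A) < d * real p"
        using IH[OF p, of A] by (auto simp: A_def not_less[symmetric])
      \<comment> \<open>A triple meeting \<open>S\<close> contains at most two of its points unless
        it lies in \<open>S\<close> completely, which adds one more.\<close>
      moreover have "3 * (\<Sum>n\<in>?Z. g n) \<le>
          (\<Sum>n\<in>?Z. 2 * indicator_mod p A n + f n * f (n + b) * f (n + 2 * b))"
        unfolding sum_distrib_left
      proof (rule sum_mono)
        fix n assume "n \<in> ?Z"
        then show "3 * g n \<le> 2 * indicator_mod p A n + f n * f (n + b) * f (n + 2 * b)"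
          using fcases[of n] fcases[of "n + b"] fcases[of "n + 2 * b"]
          by (auto simp: A_def g indicator_mod_def residue_classes_mod)
      qed
      moreover have "(\<Sum>n\<in>?Z. g n) = real (card S)"
        unfolding g_def using f(1) p0 S by (simp add: sum_smooth f_def sum_indicator_mod)
      moreover have "(\<Sum>n\<in>?Z. indicator_mod p A n) = real (card A)"
        by (rule sum_indicator_mod) (auto simp: A_def)
      ultimately show ?thesis
        using S(2) by (simp add: sum.distrib flip: sum_distrib_left)
    qed
    have "(\<Sum>b\<in>B. d * real p / 10) \<le> (\<Sum>b\<in>B. \<Sum>n\<in>?Z. f n * f (n + b) * f (n + 2 * b))"
      by (intro sum_mono G)
    also have "\<dots> \<le> (\<Sum>b\<in>?Z. \<Sum>n\<in>?Z. f n * f (n + b) * f (n + 2 * b))"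
      using f(2) by (intro sum_mono2 sum_nonneg) (auto simp: B_def)
    also have "\<dots> = ap_sum p f"
      unfolding ap_sum_def by (rule sum.swap)
    finally have sum_B: "(\<Sum>b\<in>B. d * real p / 10) \<le> ap_sum p f" .
    have "(real p)\<^sup>2 * (d / 10) \<le> real (M ^ K) * real (card B) * real p * (d / 10)"
      using cardB d by (simp add: power2_eq_square mult_right_mono)
    also have "\<dots> = real (M ^ K) * (\<Sum>b\<in>B. d * real p / 10)"
      by simp
    also have "\<dots> \<le> real (M ^ K) * ap_sum p f"
      by (intro mult_left_mono sum_B) simp
    also have "\<dots> < real (M ^ K) * (c' * (real p)\<^sup>2)"
      using small M0 by (intro mult_strict_left_mono) auto
    also have "\<dots> \<le> real (M ^ K) * (d / (10 * real (M ^ K)) * (real p)\<^sup>2)"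
      by (intro mult_left_mono mult_right_mono) (auto simp: c'_def)
    also have "\<dots> = (real p)\<^sup>2 * (d / 10)"
      using M0 by simp
    finally show False by simp
  qed
  ultimately show ?thesis by blast
qed

lemma ap_sum_1: "ap_sum p (\<lambda>_. 1) = (real p)\<^sup>2"
  by (simp add: ap_sum_def power2_eq_square)

text \<open>Induction on the density, downwards from density 1, where only the full set qualifies.
  Any factor above 2/3 could replace 7/10: the step needs \<open>3 * (7 / 10) - 2\<close> to be
  positive.\<close>

lemma varnavides:
  fixes d :: real
  assumes "d > 0"
  obtains c where "c > 0" "\<And>p S. odd p \<Longrightarrow> S \<subseteq> residue_classes p \<Longrightarrow> d * real p \<le> real (card S) \<Longrightarrow>
      c * (real p)\<^sup>2 \<le> ap_sum p (indicator_mod p S)"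
proof -
  have "\<exists>c>0. \<forall>p S. odd p \<longrightarrow> S \<subseteq> residue_classes p \<longrightarrow> (7 / 10) ^ k * real p \<le> real (card S) \<longrightarrow>
      c * (real p)\<^sup>2 \<le> ap_sum p (indicator_mod p S)" for k
  proof (induction k)
    case 0
    have "1 * (real p)\<^sup>2 \<le> ap_sum p (indicator_mod p S)"
      if "odd p" "S \<subseteq> residue_classes p" "real p \<le> real (card S)" for p S
    proof -
      have "card (residue_classes p) \<le> card S" using that by simp
      then have "S = residue_classes p"
        using that by (intro card_seteq) auto
      then have "indicator_mod p S = (\<lambda>_. 1)"
        using that odd_pos[of p] by (auto simp: indicator_mod_def)
      then show ?thesis by (simp add: ap_sum_1)
    qed
    then show ?case by (intro exI[of _ 1]) auto
  next
    case (Suc k)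
    then obtain c where "c > 0" "\<And>p S. odd p \<Longrightarrow> S \<subseteq> residue_classes p \<Longrightarrow>
        (7 / 10) ^ k * real p \<le> real (card S) \<Longrightarrow> c * (real p)\<^sup>2 \<le> ap_sum p (indicator_mod p S)"
      by blast
    from varnavides_step[OF this(1) _ this(2)] show ?case by simp
  qed
  moreover obtain k where k: "(7 / 10 :: real) ^ k < d"
    using real_arch_pow_inv[OF assms, of "7 / 10"] by auto
  ultimately obtain c where c: "c > 0" "\<And>p S. odd p \<Longrightarrow> S \<subseteq> residue_classes p \<Longrightarrow>
        (7 / 10) ^ k * real p \<le> real (card S) \<Longrightarrow> c * (real p)\<^sup>2 \<le> ap_sum p (indicator_mod p S)"
    by blast
  show thesis
  proof (rule that[OF c(1) c(2)])
    fix p S assume "d * real p \<le> real (card S)"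
    moreover have "(7 / 10) ^ k * real p \<le> d * real p"
      using k by (intro mult_right_mono) auto
    ultimately show "(7 / 10) ^ k * real p \<le> real (card S)" by linarith
  qed
qed

section \<open>Random affine images\<close>

text \<open>Non-trivial progressions are split off because affine maps equidistribute pairs of
  distinct points only, and because rounding needs progressions that contain no point twice.\<close>

definition ap_sum_nt :: "nat \<Rightarrow> (int \<Rightarrow> real) \<Rightarrow> real" where
  "ap_sum_nt p f = (\<Sum>n\<in>residue_classes p. \<Sum>m\<in>residue_classes p - {0}. f n * f (n + m) * f (n + 2 * m))"

lemma ap_sum_eq_ap_sum_nt:
  assumes "p > 0"
  shows "ap_sum p f = (\<Sum>n\<in>residue_classes p. f n ^ 3) + ap_sum_nt p f"
proof -
  have "0 \<in> residue_classes p"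
    using assms by (simp add: residue_classes_def)
  then have "ap_sum p f = (\<Sum>n\<in>residue_classes p. f n ^ 3 +
      (\<Sum>m\<in>residue_classes p - {0}. f n * f (n + m) * f (n + 2 * m)))"
    unfolding ap_sum_def
    by (intro sum.cong refl) (subst sum.remove[of _ 0], simp_all add: power3_eq_cube)
  then show ?thesis by (simp add: sum.distrib ap_sum_nt_def)
qed

lemma ap_sum_nt_nonneg: "(\<And>n. 0 \<le> f n) \<Longrightarrow> 0 \<le> ap_sum_nt p f"
  unfolding ap_sum_nt_def by (intro sum_nonneg mult_nonneg_nonneg)

lemma coprime_residue_class:
  assumes "prime p" "m \<in> residue_classes p - {0}"
  shows "coprime m (int p)"
proof -
  have "\<not> int p dvd m"
    using assms(2) zdvd_not_zless[of m "int p"] by (auto simp: residue_classes_def)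
  moreover have "prime (int p)" using assms(1) by simp
  ultimately show ?thesis
    using prime_imp_coprime[of "int p" m] by (simp add: coprime_commute)
qed

lemma sum_rotate:
  "(\<Sum>a\<in>A. \<Sum>b\<in>B. \<Sum>c\<in>C. f a b c) = (\<Sum>b\<in>B. \<Sum>c\<in>C. \<Sum>a\<in>A. f a b c)"
  by (subst sum.swap, rule sum.cong[OF refl], rule sum.swap)

lemma sum_rotate_pairs:
  "(\<Sum>a\<in>A. \<Sum>b\<in>B. \<Sum>c\<in>C. \<Sum>d\<in>D. f a b c d) = (\<Sum>c\<in>C. \<Sum>d\<in>D. \<Sum>a\<in>A. \<Sum>b\<in>B. f a b c d)"
proof -
  have "(\<Sum>a\<in>A. \<Sum>b\<in>B. \<Sum>c\<in>C. \<Sum>d\<in>D. f a b c d) = (\<Sum>a\<in>A. \<Sum>c\<in>C. \<Sum>d\<in>D. \<Sum>b\<in>B. f a b c d)"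
    by (rule sum.cong[OF refl], rule sum_rotate)
  also have "\<dots> = (\<Sum>c\<in>C. \<Sum>d\<in>D. \<Sum>a\<in>A. \<Sum>b\<in>B. f a b c d)"
    by (rule sum_rotate)
  finally show ?thesis .
qed

text \<open>The affine maps \<open>n \<mapsto> u n + v\<close> carry a pair \<open>n\<close>, \<open>n + m\<close> with \<open>m \<noteq> 0\<close> to every pair
  exactly once.\<close>

lemma sum_affine_pair:
  fixes F :: "int \<Rightarrow> int \<Rightarrow> 'a::comm_monoid_add"
  assumes p: "p > 0" and m: "coprime m (int p)"
    and F: "\<And>y. periodic p (\<lambda>x. F x y)" "\<And>x. periodic p (F x)"
  shows "(\<Sum>u\<in>residue_classes p. \<Sum>v\<in>residue_classes p. F (u * n + v) (u * m)) =
         (\<Sum>x\<in>residue_classes p. \<Sum>y\<in>residue_classes p. F x y)"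
proof -
  let ?Z = "residue_classes p"
  have "(\<Sum>u\<in>?Z. \<Sum>v\<in>?Z. F (u * n + v) (u * m)) = (\<Sum>u\<in>?Z. \<Sum>v\<in>?Z. F v (m * u))"
  proof (rule sum.cong[OF refl])
    fix u
    show "(\<Sum>v\<in>?Z. F (u * n + v) (u * m)) = (\<Sum>v\<in>?Z. F v (m * u))"
      using sum_shift[OF p F(1)[of "u * m"], of "u * n"] by (simp add: add.commute mult.commute)
  qed
  also have "\<dots> = (\<Sum>v\<in>?Z. \<Sum>u\<in>?Z. F v (m * u))"
    by (rule sum.swap)
  also have "\<dots> = (\<Sum>v\<in>?Z. \<Sum>u\<in>?Z. F v u)"
  proof (rule sum.cong[OF refl])
    fix v
    show "(\<Sum>u\<in>?Z. F v (m * u)) = (\<Sum>u\<in>?Z. F v u)"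
      using sum_affine[OF p F(2) m, of v 0] by simp
  qed
  finally show ?thesis .
qed

text \<open>Every non-trivial progression is carried onto each progression of \<open>w\<close>
  exactly once, so the sum factors. Since \<open>u = 0\<close> is included, the trivial progressions
  of \<open>w\<close> are met as well and the full \<open>ap_sum p w\<close> appears.\<close>

lemma sum_ap_sum_nt_affine:
  assumes p: "prime p" and w: "periodic p w"
  shows "(\<Sum>u\<in>residue_classes p. \<Sum>v\<in>residue_classes p.
           ap_sum_nt p (\<lambda>n. g n * w (u * n + v))) = ap_sum_nt p g * ap_sum p w"
proof -
  let ?Z = "residue_classes p"
  have p0: "p > 0" using p by (simp add: prime_gt_0_nat)
  have inner: "(\<Sum>u\<in>?Z. \<Sum>v\<in>?Z. w (u * n + v) * w (u * n + v + u * m) * w (u * n + v + 2 * (u * m))) =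
      ap_sum p w" if "m \<in> ?Z - {0}" for n m
  proof -
    have per: "periodic p (\<lambda>x. w x * w (x + y) * w (x + 2 * y))"
         "periodic p (\<lambda>y. w x * w (x + y) * w (x + 2 * y))" for x y
      by (intro periodicI arg_cong2[where f = "(*)"] periodic_cong[OF w] cong_add cong_refl
          cong_scalar_left; assumption)+
    show ?thesis
      unfolding ap_sum_def
      by (rule sum_affine_pair[OF p0 coprime_residue_class[OF p that],
            of "\<lambda>x y. w x * w (x + y) * w (x + 2 * y)"]) (rule per)+
  qed
  have "(\<Sum>u\<in>?Z. \<Sum>v\<in>?Z. ap_sum_nt p (\<lambda>n. g n * w (u * n + v))) =
     (\<Sum>u\<in>?Z. \<Sum>v\<in>?Z. \<Sum>n\<in>?Z. \<Sum>m\<in>?Z - {0}. (g n * g (n + m) * g (n + 2 * m)) *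
        (w (u * n + v) * w (u * n + v + u * m) * w (u * n + v + 2 * (u * m))))"
    unfolding ap_sum_nt_def by (intro sum.cong refl) (simp add: algebra_simps)
  also have "\<dots> = (\<Sum>n\<in>?Z. \<Sum>m\<in>?Z - {0}. \<Sum>u\<in>?Z. \<Sum>v\<in>?Z. (g n * g (n + m) * g (n + 2 * m)) *
        (w (u * n + v) * w (u * n + v + u * m) * w (u * n + v + 2 * (u * m))))"
    by (rule sum_rotate_pairs)
  also have "\<dots> = (\<Sum>n\<in>?Z. \<Sum>m\<in>?Z - {0}. (g n * g (n + m) * g (n + 2 * m)) * ap_sum p w)"
    by (intro sum.cong refl) (simp only: sum_distrib_left[symmetric] inner)
  also have "\<dots> = ap_sum_nt p g * ap_sum p w"
    by (simp only: ap_sum_nt_def sum_distrib_right)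
  finally show ?thesis .
qed

text \<open>A second moment bound: the images of two distinct points are pairwise independent, so
  for \<open>w\<close> of mean zero all off-diagonal terms vanish. It measures how far a random
  affine image can disturb the mean of \<open>g\<close>.\<close>

lemma sum_square_affine_le:
  assumes p: "prime p" and w: "periodic p w" "(\<Sum>n\<in>residue_classes p. w n) = 0"
    and bounds: "\<And>n. \<bar>g n\<bar> \<le> 1" "\<And>n. \<bar>w n\<bar> \<le> 1"
  shows "(\<Sum>u\<in>residue_classes p. \<Sum>v\<in>residue_classes p.
           (\<Sum>n\<in>residue_classes p. g n * w (u * n + v))\<^sup>2) \<le> real p ^ 3"
proof -
  let ?Z = "residue_classes p"
  have p0: "p > 0" using p by (simp add: prime_gt_0_nat)
  have off: "(\<Sum>u\<in>?Z. \<Sum>v\<in>?Z. w (u * n + v) * w (u * m + v)) = 0"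
    if nm: "n \<in> ?Z" "m \<in> ?Z" "m \<noteq> n" for n m
  proof -
    have "\<not> int p dvd m - n"
      using residue_classes_cong_imp_eq[of m p n] nm by (auto simp: cong_iff_dvd_diff)
    moreover have "prime (int p)" using p by simp
    ultimately have cop: "coprime (m - n) (int p)"
      using prime_imp_coprime[of "int p" "m - n"] by (simp add: coprime_commute)
    have per: "periodic p (\<lambda>x. w x * w (x + y))" "periodic p (\<lambda>y. w x * w (x + y))" for x y
      by (intro periodicI arg_cong2[where f = "(*)"] periodic_cong[OF w(1)] cong_add cong_refl;
          assumption)+
    have "(\<Sum>u\<in>?Z. \<Sum>v\<in>?Z. w (u * n + v) * w (u * m + v)) =
        (\<Sum>u\<in>?Z. \<Sum>v\<in>?Z. w (u * n + v) * w (u * n + v + u * (m - n)))"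
      by (simp add: algebra_simps)
    also have "\<dots> = (\<Sum>x\<in>?Z. \<Sum>y\<in>?Z. w x * w (x + y))"
      by (rule sum_affine_pair[OF p0 cop, of "\<lambda>x y. w x * w (x + y)"]) (rule per)+
    also have "\<dots> = (\<Sum>x\<in>?Z. w x * (\<Sum>y\<in>?Z. w (y + x)))"
      by (simp add: sum_distrib_left add.commute)
    also have "\<dots> = 0"
      using sum_shift[OF p0 w(1)] w(2) by simp
    finally show ?thesis .
  qed
  have "(\<Sum>u\<in>?Z. \<Sum>v\<in>?Z. (\<Sum>n\<in>?Z. g n * w (u * n + v))\<^sup>2) =
      (\<Sum>u\<in>?Z. \<Sum>v\<in>?Z. \<Sum>n\<in>?Z. \<Sum>m\<in>?Z. (g n * g m) * (w (u * n + v) * w (u * m + v)))"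
    unfolding power2_eq_square sum_product by (simp add: mult_ac)
  also have "\<dots> = (\<Sum>n\<in>?Z. \<Sum>m\<in>?Z. \<Sum>u\<in>?Z. \<Sum>v\<in>?Z. (g n * g m) * (w (u * n + v) * w (u * m + v)))"
    by (rule sum_rotate_pairs)
  also have "\<dots> = (\<Sum>n\<in>?Z. \<Sum>m\<in>?Z. (g n * g m) * (\<Sum>u\<in>?Z. \<Sum>v\<in>?Z. w (u * n + v) * w (u * m + v)))"
    by (simp only: sum_distrib_left)
  also have "\<dots> = (\<Sum>n\<in>?Z. \<Sum>m\<in>?Z. if m = n then
      (g n * g n) * (\<Sum>u\<in>?Z. \<Sum>v\<in>?Z. w (u * n + v) * w (u * n + v)) else 0)"
  proof (intro sum.cong refl)
    fix n m assume "n \<in> ?Z" "m \<in> ?Z"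
    then show "(g n * g m) * (\<Sum>u\<in>?Z. \<Sum>v\<in>?Z. w (u * n + v) * w (u * m + v)) = (if m = n then
      (g n * g n) * (\<Sum>u\<in>?Z. \<Sum>v\<in>?Z. w (u * n + v) * w (u * n + v)) else 0)"
      using off[of n m] by (cases "m = n") simp_all
  qed
  also have "\<dots> = (\<Sum>n\<in>?Z. \<Sum>u\<in>?Z. \<Sum>v\<in>?Z. (g n * g n) * (w (u * n + v) * w (u * n + v)))"
    by (simp add: sum_distrib_left)
  also have "\<dots> \<le> (\<Sum>n\<in>?Z. \<Sum>u\<in>?Z. \<Sum>v\<in>?Z. 1 * 1)"
    using bounds by (intro sum_mono mult_mono) (auto simp: abs_square_le_1 simp flip: power2_eq_square)
  also have "\<dots> = real p ^ 3" by (simp add: power3_eq_cube)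
  finally show ?thesis .
qed

section \<open>Progressions in the complement of an interval\<close>

text \<open>Inclusion and exclusion: any two terms of a progression range over all pairs of residues
  (for the outer two this uses that \<open>p\<close> is odd), so everything but the cubic term
  depends only on \<open>s\<close>.\<close>

lemma ap_sum_one_minus:
  assumes p: "p > 0" "odd p" and f: "periodic p f"
  defines "s \<equiv> (\<Sum>n\<in>residue_classes p. f n)"
  shows "ap_sum p (\<lambda>n. 1 - f n) = (real p)\<^sup>2 - 3 * real p * s + 3 * s\<^sup>2 - ap_sum p f"
proof -
  let ?Z = "residue_classes p"
  have cop2: "coprime 2 (int p)" using p(2) by simp
  have s1: "(\<Sum>m\<in>?Z. f (n + m)) = s" for n
    using sum_shift[OF p(1) f, of n] by (simp add: s_def add.commute)
  have s2: "(\<Sum>m\<in>?Z. f (n + 2 * m)) = s" for n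
    using sum_affine[OF p(1) f cop2, of n] by (simp add: s_def add.commute)
  have s12: "(\<Sum>n\<in>?Z. \<Sum>m\<in>?Z. f (n + m) * f (n + 2 * m)) = s * s"
  proof -
    have "(\<Sum>n\<in>?Z. \<Sum>m\<in>?Z. f (n + m) * f (n + 2 * m)) =
        (\<Sum>m\<in>?Z. \<Sum>n\<in>?Z. f (n + m) * f (n + m + m))"
      by (subst sum.swap) (simp add: algebra_simps)
    also have "\<dots> = (\<Sum>m\<in>?Z. \<Sum>n\<in>?Z. f n * f (n + m))"
    proof (rule sum.cong[OF refl])
      fix m
      have "periodic p (\<lambda>n. f n * f (n + m))"
        by (intro periodicI arg_cong2[where f = "(*)"] periodic_cong[OF f] cong_add cong_refl;
            assumption)
      then show "(\<Sum>n\<in>?Z. f (n + m) * f (n + m + m)) = (\<Sum>n\<in>?Z. f n * f (n + m))"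
        using sum_shift[OF p(1), of "\<lambda>n. f n * f (n + m)" m] by simp
    qed
    also have "\<dots> = s * s"
      by (subst sum.swap) (simp only: sum_distrib_left[symmetric] s1 sum_distrib_right[symmetric] s_def[symmetric])
    finally show ?thesis .
  qed
  have "ap_sum p (\<lambda>n. 1 - f n) = (\<Sum>n\<in>?Z. \<Sum>m\<in>?Z. 1 - f n - f (n + m) - f (n + 2 * m) +
      f n * f (n + m) + f n * f (n + 2 * m) + f (n + m) * f (n + 2 * m) -
      f n * f (n + m) * f (n + 2 * m))"
    unfolding ap_sum_def by (simp add: algebra_simps)
  also have "\<dots> = (\<Sum>n\<in>?Z. \<Sum>m\<in>?Z. 1) - (\<Sum>n\<in>?Z. \<Sum>m\<in>?Z. f n) - (\<Sum>n\<in>?Z. \<Sum>m\<in>?Z. f (n + m)) -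
      (\<Sum>n\<in>?Z. \<Sum>m\<in>?Z. f (n + 2 * m)) + (\<Sum>n\<in>?Z. \<Sum>m\<in>?Z. f n * f (n + m)) +
      (\<Sum>n\<in>?Z. \<Sum>m\<in>?Z. f n * f (n + 2 * m)) + (\<Sum>n\<in>?Z. \<Sum>m\<in>?Z. f (n + m) * f (n + 2 * m)) - ap_sum p f"
    by (simp only: sum.distrib sum_subtractf ap_sum_def)
  also have "(\<Sum>n\<in>?Z. \<Sum>m\<in>?Z. f n * f (n + m)) = s * s"
    by (simp only: sum_distrib_left[symmetric] s1 sum_distrib_right[symmetric] s_def[symmetric])
  also have "(\<Sum>n\<in>?Z. \<Sum>m\<in>?Z. f n * f (n + 2 * m)) = s * s"
    by (simp only: sum_distrib_left[symmetric] s2 sum_distrib_right[symmetric] s_def[symmetric])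
  also have "(\<Sum>n\<in>?Z. \<Sum>m\<in>?Z. f n) = real p * s"
    by (simp add: s_def flip: sum_distrib_left)
  finally show ?thesis
    by (simp add: s1 s2 s12 power2_eq_square)
qed

lemma sum_half_descending_ge:
  "(real q)\<^sup>2 / 4 \<le> (\<Sum>n<q. (real q - real n) / 2)"
proof -
  have "(\<Sum>n<q. (real q - real n) / 2) = (real q)\<^sup>2 / 4 + real q / 4"
  proof -
    have "(\<Sum>n<q. r - real n) = real q * r - real q * (real q - 1) / 2" for r
      by (induction q) (auto simp: field_simps)
    from this[of "real q"] show ?thesis
      by (simp add: power2_eq_square field_simps flip: sum_divide_distrib)
  qed
  then show ?thesis by simp
qed

text \<open>Only non-negative differences that avoid wrapping around are counted: about
  \<open>(q - n) / 2\<close> for the start \<open>n\<close>. The loss of a constant factor is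
  harmless.\<close>

lemma ap_sum_interval_ge:
  assumes q: "q \<le> p"
  shows "ap_sum p (indicator_mod p {0..<int q}) \<ge> (real q)\<^sup>2 / 4"
proof -
  let ?Z = "residue_classes p"
  define f where "f = indicator_mod p {0..<int q}"
  have f0: "f n \<ge> 0" for n by (simp add: f_def)
  have f1: "f n = 1" if "0 \<le> n" "n < int q" for n
    using that q by (simp add: f_def indicator_mod_def)
  have inner: "(real q - real n) / 2 \<le> (\<Sum>m\<in>?Z. f (int n) * f (int n + m) * f (int n + 2 * m))"
    if n: "n < q" for n
  proof -
    \<comment> \<open>The rounded-up half of \<open>q - n\<close>, that is, the number of
      \<open>m >= 0\<close> with \<open>n + 2 * m < q\<close>.\<close>
    define k where "k = (q - n + 1) div 2"
    have k: "2 * k \<le> q - n + 1" "q - n \<le> 2 * k" "k \<le> q" using n by (auto simp: k_def)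
    have "real (q - n) \<le> real (2 * k)"
      using k(2) by (rule of_nat_mono)
    then have "(real q - real n) / 2 \<le> real k"
      using n by (simp add: of_nat_diff)
    also have "real k = (\<Sum>m\<in>{0..<int k}. 1)" by simp
    also have "\<dots> \<le> (\<Sum>m\<in>{0..<int k}. f (int n) * f (int n + m) * f (int n + 2 * m))"
    proof (rule sum_mono)
      fix m assume "m \<in> {0..<int k}"
      then have m: "0 \<le> m" "2 * m < int q - int n" using k n by auto
      then have "f (int n) = 1" "f (int n + m) = 1" "f (int n + 2 * m) = 1"
        by (auto intro!: f1)
      then show "1 \<le> f (int n) * f (int n + m) * f (int n + 2 * m)" by simp
    qed
    also have "\<dots> \<le> (\<Sum>m\<in>?Z. f (int n) * f (int n + m) * f (int n + 2 * m))"
      using k q f0 by (intro sum_mono2) (auto simp: residue_classes_def)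
    finally show ?thesis .
  qed
  have "(real q)\<^sup>2 / 4 \<le> (\<Sum>n<q. (real q - real n) / 2)"
    by (rule sum_half_descending_ge)
  also have "\<dots> \<le> (\<Sum>n<q. \<Sum>m\<in>?Z. f (int n) * f (int n + m) * f (int n + 2 * m))"
    using inner by (intro sum_mono) auto
  also have "\<dots> = (\<Sum>n\<in>int ` {..<q}. \<Sum>m\<in>?Z. f n * f (n + m) * f (n + 2 * m))"
    by (simp add: sum.reindex)
  also have "\<dots> \<le> ap_sum p f"
    unfolding ap_sum_def using q f0
    by (intro sum_mono2 sum_nonneg) (auto simp: residue_classes_def)
  finally show ?thesis by (simp add: f_def)
qed

section \<open>Thinning by a random affine image\<close>

text \<open>Averaged over all affine images, the count falls by the factor
  \<open>1 - \<beta>\<^sup>2 / 16\<close>. At most a fraction \<open>\<beta>\<^sup>2 / 32\<close> of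
  the images fails to keep the mean, so one of the others still gains
  \<open>\<beta>\<^sup>2 / 32\<close>. The lower bound on \<open>D\<close> is exactly what
  Chebyshev's inequality needs for that fraction.\<close>

lemma exists_fewer_progressions:
  assumes p: "prime p" "odd p" and g: "periodic p g" "\<And>n. 0 \<le> g n"
    and q: "q > 0" "8 * q \<le> p"
    and \<beta>: "\<beta> = real q / real p" and \<tau>: "\<tau> = \<beta>\<^sup>2 / 128"
    and g_le: "\<And>n. g n * (1 + \<tau>) \<le> 1 - \<beta>"
    and D: "D = (\<Sum>n\<in>residue_classes p. g n)" "128 * real p \<le> \<beta>\<^sup>2 * (\<tau> * D)\<^sup>2"
  obtains h where "periodic p h" "\<And>n. 0 \<le> h n" "\<And>n. h n \<le> 1"
    "D \<le> (\<Sum>n\<in>residue_classes p. h n)" "ap_sum_nt p h \<le> ap_sum_nt p g * (1 - \<beta>\<^sup>2 / 32)"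
proof -
  let ?Z = "residue_classes p"
  have p0: "p > 0" using p(1) by (simp add: prime_gt_0_nat)
  have \<beta>0: "0 < \<beta>" "\<beta> \<le> 1 / 8"
    using q p0 by (simp_all add: \<beta> field_simps)
  have \<beta>2: "\<beta>\<^sup>2 \<le> 1 / 64"
    using power_mono[of \<beta> "1 / 8" 2] \<beta>0 by (simp add: power2_eq_square)
  have \<tau>0: "0 < \<tau>" "\<tau> \<le> 1 / 8192" using \<beta>0(1) \<beta>2 by (simp_all add: \<tau>)
  define I where "I = indicator_mod p {0..<int q}"
  define w where "w n = 1 - I n" for n
  \<comment> \<open>Division by \<open>1 - \<beta>\<close> restores the mean, and
    \<open>1 + \<tau>\<close> is the overshoot. The bound \<open>g_le\<close> keeps
    \<open>s * g n\<close> at most 1.\<close>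
  define s where "s = (1 + \<tau>) / (1 - \<beta>)"
  have s: "0 < s" "s \<le> 2" "s * (1 - \<beta>) = 1 + \<tau>"
    using \<beta>0 \<tau>0 by (auto simp: s_def field_simps)
  have I: "periodic p I" "\<And>n. 0 \<le> I n" "\<And>n. I n \<le> 1"
    by (simp_all add: I_def periodic_indicator_mod)
  have sumI: "(\<Sum>n\<in>?Z. I n) = real q"
    using q unfolding I_def by (subst sum_indicator_mod) (auto simp: residue_classes_def)
  have w: "periodic p w" using I(1) by (simp add: w_def periodic_def)
  have w01: "0 \<le> w n" "w n \<le> 1" for n using I by (simp_all add: w_def)
  have q_eq: "real q = \<beta> * real p" using p0 by (simp add: \<beta>)
  have sumw: "(\<Sum>n\<in>?Z. w n - (1 - \<beta>)) = 0"
    by (simp add: w_def sum_subtractf sumI q_eq algebra_simps)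
  have ap_w: "s ^ 3 * ap_sum p w \<le> (real p)\<^sup>2 * (1 - \<beta>\<^sup>2 / 16)"
  proof -
    have "ap_sum p w = (real p)\<^sup>2 - 3 * real p * real q + 3 * (real q)\<^sup>2 - ap_sum p I"
      unfolding w_def using ap_sum_one_minus[OF p0 p(2) I(1)] by (simp add: sumI)
    also have "\<dots> \<le> (real p)\<^sup>2 - 3 * real p * real q + 3 * (real q)\<^sup>2 - (real q)\<^sup>2 / 4"
      using ap_sum_interval_ge[of q p] q by (simp add: I_def)
    \<comment> \<open>Compared with \<open>(1 - \<beta>) ^ 3\<close>, the gain is
      \<open>\<beta>\<^sup>2 / 4 - \<beta> ^ 3\<close>; half of \<open>\<beta>\<^sup>2 / 4\<close>
      absorbs the cube because \<open>\<beta> \<le> 1 / 8\<close>.\<close>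
    also have "\<dots> = (real p)\<^sup>2 * ((1 - \<beta>) ^ 3 - \<beta>\<^sup>2 / 8 - \<beta>\<^sup>2 * (1 / 8 - \<beta>))"
      by (simp add: q_eq power2_eq_square power3_eq_cube algebra_simps)
    also have "\<dots> \<le> (real p)\<^sup>2 * ((1 - \<beta>) ^ 3 * (1 - \<beta>\<^sup>2 / 8))"
    proof (rule mult_left_mono)
      have "0 \<le> \<beta>\<^sup>2 * (1 / 8 - \<beta>)" using \<beta>0 by simp
      moreover have "(1 - \<beta>) ^ 3 * (\<beta>\<^sup>2 / 8) \<le> 1 * (\<beta>\<^sup>2 / 8)"
        using \<beta>0 by (intro mult_right_mono power_le_one) auto
      ultimately show "(1 - \<beta>) ^ 3 - \<beta>\<^sup>2 / 8 - \<beta>\<^sup>2 * (1 / 8 - \<beta>) \<le> (1 - \<beta>) ^ 3 * (1 - \<beta>\<^sup>2 / 8)"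
        by (simp add: right_diff_distrib)
    qed simp
    finally have "s ^ 3 * ap_sum p w \<le> s ^ 3 * ((real p)\<^sup>2 * ((1 - \<beta>) ^ 3 * (1 - \<beta>\<^sup>2 / 8)))"
      using s by (intro mult_left_mono) auto
    also have "\<dots> = (real p)\<^sup>2 * ((s * (1 - \<beta>)) ^ 3 * (1 - \<beta>\<^sup>2 / 8))"
      by (simp add: power_mult_distrib)
    also have "\<dots> \<le> (real p)\<^sup>2 * (1 - \<beta>\<^sup>2 / 16)"
    proof (rule mult_left_mono)
      have "\<tau> * (\<tau> * \<tau>) \<le> \<tau> * (1 / 8)" "\<tau> * \<tau> \<le> \<tau> * (1 / 8)"
      proof -
        show "\<tau> * \<tau> \<le> \<tau> * (1 / 8)" using \<tau>0 by (intro mult_left_mono) auto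
        have "\<tau> * \<tau> \<le> 1 * (1 / 8)" using \<tau>0 by (intro mult_mono) auto
        then show "\<tau> * (\<tau> * \<tau>) \<le> \<tau> * (1 / 8)" using \<tau>0 by (intro mult_left_mono) auto
      qed
      moreover have "(1 + \<tau>) ^ 3 = 1 + 3 * \<tau> + 3 * (\<tau> * \<tau>) + \<tau> * (\<tau> * \<tau>)"
        by (simp add: power3_eq_cube algebra_simps)
      \<comment> \<open>The choice of 128 in \<open>\<tau>\<close> makes \<open>4 * \<tau>\<close>
        equal to \<open>\<beta>\<^sup>2 / 32\<close>, so the overshoot costs only part of the gain
        \<open>\<beta>\<^sup>2 / 8\<close>.\<close>
      ultimately have "(1 + \<tau>) ^ 3 \<le> 1 + 4 * \<tau>" using \<tau>0(1) by linarith
      then have "(1 + \<tau>) ^ 3 * (1 - \<beta>\<^sup>2 / 8) \<le> (1 + \<beta>\<^sup>2 / 32) * (1 - \<beta>\<^sup>2 / 8)"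
        using \<beta>2 by (intro mult_right_mono) (auto simp: \<tau>)
      also have "\<dots> = 1 - 3 / 32 * \<beta>\<^sup>2 - (\<beta>\<^sup>2 * \<beta>\<^sup>2) / 256"
        by (simp add: field_simps)
      also have "\<dots> \<le> 1 - \<beta>\<^sup>2 / 16"
      proof -
        have "0 \<le> \<beta>\<^sup>2" "0 \<le> \<beta>\<^sup>2 * \<beta>\<^sup>2" by simp_all
        then show ?thesis by linarith
      qed
      finally show "(s * (1 - \<beta>)) ^ 3 * (1 - \<beta>\<^sup>2 / 8) \<le> 1 - \<beta>\<^sup>2 / 16" by (simp add: s(3))
    qed simp
    finally show ?thesis .
  qed
  define h where "h x n = s * g n * w (fst x * n + snd x)" for x :: "int \<times> int" and n
  define X where "X = ap_sum_nt p g * (1 - \<beta>\<^sup>2 / 32)"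
  have ntg: "0 \<le> ap_sum_nt p g" by (rule ap_sum_nt_nonneg[OF g(2)])
  have total: "(\<Sum>x\<in>?Z \<times> ?Z. ap_sum_nt p (h x)) \<le> (real p)\<^sup>2 * (ap_sum_nt p g * (1 - \<beta>\<^sup>2 / 16))"
  proof -
    have "(\<Sum>x\<in>?Z \<times> ?Z. ap_sum_nt p (h x)) = ap_sum_nt p (\<lambda>n. s * g n) * ap_sum p w"
      unfolding sum_ap_sum_nt_affine[OF p(1) w, symmetric] sum.cartesian_product h_def
      by (simp add: case_prod_unfold)
    also have "ap_sum_nt p (\<lambda>n. s * g n) = s ^ 3 * ap_sum_nt p g"
      unfolding ap_sum_nt_def by (simp add: sum_distrib_left power3_eq_cube mult_ac)
    also have "s ^ 3 * ap_sum_nt p g * ap_sum p w = ap_sum_nt p g * (s ^ 3 * ap_sum p w)"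
      by simp
    also have "\<dots> \<le> ap_sum_nt p g * ((real p)\<^sup>2 * (1 - \<beta>\<^sup>2 / 16))"
      by (intro mult_left_mono ap_w ntg)
    finally show ?thesis by (simp add: mult_ac)
  qed
  define good where "good = {x \<in> ?Z \<times> ?Z. D \<le> (\<Sum>n\<in>?Z. h x n)}"
  define bad where "bad = {x \<in> ?Z \<times> ?Z. (\<Sum>n\<in>?Z. h x n) < D}"
  have bad: "real (card bad) \<le> (real p)\<^sup>2 * (\<beta>\<^sup>2 / 32)"
  proof -
    define Y where "Y x = (\<Sum>n\<in>?Z. g n * (w (fst x * n + snd x) - (1 - \<beta>)))" for x :: "int \<times> int"
    have D0: "0 \<le> D" unfolding D by (intro sum_nonneg g)
    \<comment> \<open>\<open>Y\<close> is the deviation from the average. In a bad image it must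
      cancel the whole overshoot \<open>\<tau> * D\<close>; the factor 4 is the square of the bound
      \<open>s \<le> 2\<close>.\<close>
    have Y: "(\<tau> * D)\<^sup>2 \<le> 4 * (Y x)\<^sup>2" if "x \<in> bad" for x
    proof -
      have "(\<Sum>n\<in>?Z. h x n) = (\<Sum>n\<in>?Z. s * (g n * (w (fst x * n + snd x) - (1 - \<beta>))) + s * (1 - \<beta>) * g n)"
        by (intro sum.cong) (auto simp: h_def algebra_simps)
      also have "\<dots> = s * Y x + s * (1 - \<beta>) * D"
        by (simp add: sum.distrib Y_def D flip: sum_distrib_left)
      finally have "s * Y x + (1 + \<tau>) * D < D"
        using that by (simp add: bad_def s(3))
      then have lt: "\<tau> * D < s * (- Y x)" by (simp add: algebra_simps)
      then have "0 < s * (- Y x)"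
        using D0 \<tau>0(1) by (meson less_imp_le mult_nonneg_nonneg order_le_less_trans)
      then have "0 \<le> - Y x" using s(1) by (auto simp: mult_less_0_iff)
      then have "s * (- Y x) \<le> 2 * (- Y x)" using s(2) by (intro mult_right_mono) auto
      with lt have "\<tau> * D \<le> 2 * (- Y x)" by linarith
      then have "(\<tau> * D)\<^sup>2 \<le> (2 * (- Y x))\<^sup>2"
        using D0 \<tau>0(1) by (intro power_mono) auto
      then show ?thesis by (simp add: power_mult_distrib)
    qed
    have "real (card bad) * (\<tau> * D)\<^sup>2 \<le> (\<Sum>x\<in>bad. 4 * (Y x)\<^sup>2)"
      by (intro sum_bounded_below Y)
    also have "\<dots> \<le> (\<Sum>x\<in>?Z \<times> ?Z. 4 * (Y x)\<^sup>2)"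
      by (intro sum_mono2) (auto simp: bad_def)
    also have "\<dots> = 4 * (\<Sum>u\<in>?Z. \<Sum>v\<in>?Z. (\<Sum>n\<in>?Z. g n * (w (u * n + v) - (1 - \<beta>)))\<^sup>2)"
      unfolding sum.cartesian_product Y_def by (simp add: case_prod_unfold flip: sum_distrib_left)
    also have "\<dots> \<le> 4 * real p ^ 3"
    proof (intro mult_left_mono sum_square_affine_le[OF p(1), of "\<lambda>n. w n - (1 - \<beta>)"])
      show "periodic p (\<lambda>n. w n - (1 - \<beta>))" using w by (simp add: periodic_def)
      show "(\<Sum>n\<in>?Z. w n - (1 - \<beta>)) = 0" by (rule sumw)
      fix n
      have "g n * 1 \<le> g n * (1 + \<tau>)" using g(2) \<tau>0 by (intro mult_left_mono) auto
      then show "\<bar>g n\<bar> \<le> 1" using g_le[of n] g(2)[of n] \<beta>0 by simp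
      show "\<bar>w n - (1 - \<beta>)\<bar> \<le> 1" using w01[of n] \<beta>0 by (auto simp: abs_if)
    qed simp
    finally have "real (card bad) * (\<tau> * D)\<^sup>2 * \<beta>\<^sup>2 \<le> 4 * real p ^ 3 * \<beta>\<^sup>2"
      by (rule mult_right_mono) simp
    moreover have "real (card bad) * (128 * real p) \<le> real (card bad) * (\<beta>\<^sup>2 * (\<tau> * D)\<^sup>2)"
      by (intro mult_left_mono D) simp
    ultimately have "real (card bad) * (128 * real p) \<le> 4 * real p ^ 3 * \<beta>\<^sup>2"
      by (simp add: mult_ac)
    then have "real p * (128 * real (card bad)) \<le> real p * (4 * ((real p)\<^sup>2 * \<beta>\<^sup>2))"
      by (simp add: power2_eq_square power3_eq_cube mult_ac)
    then have "128 * real (card bad) \<le> 4 * ((real p)\<^sup>2 * \<beta>\<^sup>2)"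
      using p0 by (simp only: mult_le_cancel_left_pos of_nat_0_less_iff)
    then show ?thesis by (simp add: mult_ac)
  qed
  have "card good + card bad = p * p"
  proof -
    have "good \<union> bad = ?Z \<times> ?Z" by (auto simp: good_def bad_def)
    moreover have "card (good \<union> bad) = card good + card bad"
      by (rule card_Un_disjoint) (auto simp: good_def bad_def)
    ultimately show ?thesis by (simp add: card_cartesian_product)
  qed
  then have "real (card good) + real (card bad) = (real p)\<^sup>2"
    by (metis of_nat_add of_nat_mult power2_eq_square)
  then have good: "(real p)\<^sup>2 * (1 - \<beta>\<^sup>2 / 32) \<le> real (card good)"
    using bad by (simp add: right_diff_distrib)
  moreover have "0 < (real p)\<^sup>2 * (1 - \<beta>\<^sup>2 / 32)" using p0 \<beta>2 by (intro mult_pos_pos) auto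
  ultimately have "good \<noteq> {}" by fastforce
  have fin_good: "finite good" by (simp add: good_def)
  have X0: "0 \<le> X" using ntg \<beta>2 by (simp add: X_def)
  have "\<exists>x\<in>good. ap_sum_nt p (h x) \<le> X"
  proof (rule ccontr)
    assume "\<not> (\<exists>x\<in>good. ap_sum_nt p (h x) \<le> X)"
    then have "(\<Sum>x\<in>good. X) < (\<Sum>x\<in>good. ap_sum_nt p (h x))"
      using \<open>good \<noteq> {}\<close> fin_good by (intro sum_strict_mono) (auto simp: not_le)
    also have "\<dots> \<le> (\<Sum>x\<in>?Z \<times> ?Z. ap_sum_nt p (h x))"
      using s(1) g(2) w01
      by (intro sum_mono2 ap_sum_nt_nonneg) (auto simp: good_def h_def)
    also note total
    finally have "real (card good) * X < (real p)\<^sup>2 * (ap_sum_nt p g * (1 - \<beta>\<^sup>2 / 16))"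
      by simp
    moreover have "(real p)\<^sup>2 * (1 - \<beta>\<^sup>2 / 32) * X \<le> real (card good) * X"
      by (intro mult_right_mono good X0)
    moreover have "(real p)\<^sup>2 * (ap_sum_nt p g * (1 - \<beta>\<^sup>2 / 16)) \<le> (real p)\<^sup>2 * (1 - \<beta>\<^sup>2 / 32) * X"
    proof -
      \<comment> \<open>Half of the gain pays for restricting the average to good images.\<close>
      have "1 - \<beta>\<^sup>2 / 16 \<le> (1 - \<beta>\<^sup>2 / 32) * (1 - \<beta>\<^sup>2 / 32)"
        by (simp add: algebra_simps)
      then have "(real p)\<^sup>2 * (ap_sum_nt p g * (1 - \<beta>\<^sup>2 / 16)) \<le>
          (real p)\<^sup>2 * (ap_sum_nt p g * ((1 - \<beta>\<^sup>2 / 32) * (1 - \<beta>\<^sup>2 / 32)))"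
        using ntg by (intro mult_left_mono) auto
      then show ?thesis by (simp add: X_def mult_ac)
    qed
    ultimately show False by linarith
  qed
  then obtain x where x: "x \<in> good" "ap_sum_nt p (h x) \<le> X" by blast
  show thesis
  proof (rule that[of "h x"])
    show "periodic p (h x)"
    proof (rule periodicI)
      fix m n assume mn: "[m = n] (mod int p)"
      then have "[fst x * m + snd x = fst x * n + snd x] (mod int p)"
        by (intro cong_add cong_scalar_left cong_refl)
      then show "h x m = h x n"
        unfolding h_def by (simp only: periodic_cong[OF g(1) mn] periodic_cong[OF w])
    qed
    show "0 \<le> h x n" for n using s(1) g(2) w01 by (simp add: h_def)
    show "h x n \<le> 1" for n
    proof -
      have "h x n \<le> s * g n * 1" unfolding h_def using s(1) g(2) w01 by (intro mult_left_mono) auto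
      also have "s * g n = (g n * (1 + \<tau>)) / (1 - \<beta>)" by (simp add: s_def)
      also have "(g n * (1 + \<tau>)) / (1 - \<beta>) * 1 \<le> 1" using g_le[of n] \<beta>0 by simp
      finally show ?thesis .
    qed
    show "D \<le> (\<Sum>n\<in>?Z. h x n)" using x(1) by (simp add: good_def)
    show "ap_sum_nt p (h x) \<le> ap_sum_nt p g * (1 - \<beta>\<^sup>2 / 32)" using x(2) by (simp add: X_def)
  qed
qed

section \<open>Rounding to a set\<close>

text \<open>Adding a positive multiple moves weight from \<open>y\<close> to \<open>x\<close>, a
  negative one moves it back; for representatives \<open>x\<close> and \<open>y\<close> the total is
  unchanged.\<close>

definition transfer :: "nat \<Rightarrow> int \<Rightarrow> int \<Rightarrow> int \<Rightarrow> real" where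
  "transfer p x y n = of_bool (n mod int p = x) - of_bool (n mod int p = y)"

lemma ap_terms_distinct:
  assumes p: "odd p" and m: "m \<in> residue_classes p - {0}"
  shows "n mod int p \<noteq> (n + m) mod int p" "n mod int p \<noteq> (n + 2 * m) mod int p"
    "(n + m) mod int p \<noteq> (n + 2 * m) mod int p"
proof -
  have m_ndvd: "\<not> int p dvd m"
    using m zdvd_not_zless[of m "int p"] by (auto simp: residue_classes_def)
  have "coprime (int p) 2" using p by simp
  then have "\<not> int p dvd 2 * m" using m_ndvd by (simp add: coprime_dvd_mult_right_iff)
  then show "n mod int p \<noteq> (n + m) mod int p" "n mod int p \<noteq> (n + 2 * m) mod int p"
    "(n + m) mod int p \<noteq> (n + 2 * m) mod int p"
    using m_ndvd by (simp_all add: mod_eq_dvd_iff)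
qed

text \<open>Along a transfer of weight from one point to another the number of progressions is
  concave, since no non-trivial progression contains a point twice.\<close>

lemma ap_sum_nt_transfer:
  assumes p: "odd p" and xy: "x \<noteq> y" and h: "\<And>n. 0 \<le> h n"
  obtains B C where "C \<le> 0"
    "\<And>t. ap_sum_nt p (\<lambda>n. h n + t * transfer p x y n) = ap_sum_nt p h + B * t + C * t\<^sup>2"
proof -
  let ?Z = "residue_classes p"
  define e where "e = transfer p x y"
  \<comment> \<open>\<open>e\<close> is supported on the classes of \<open>x\<close> and
    \<open>y\<close> with opposite signs: two distinct points give a product of at most 0, and three
    distinct points cannot all lie in the support.\<close>
  have e2: "e a * e b \<le> 0" if "a mod int p \<noteq> b mod int p" for a b
    using that xy by (auto simp: e_def transfer_def)
  have e3: "e a * e b * e c = 0"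
    if "a mod int p \<noteq> b mod int p" "a mod int p \<noteq> c mod int p" "b mod int p \<noteq> c mod int p" for a b c
    using that xy by (auto simp: e_def transfer_def)
  define B where "B = (\<Sum>n\<in>?Z. \<Sum>m\<in>?Z - {0}. e n * h (n + m) * h (n + 2 * m) +
     h n * e (n + m) * h (n + 2 * m) + h n * h (n + m) * e (n + 2 * m))"
  define C where "C = (\<Sum>n\<in>?Z. \<Sum>m\<in>?Z - {0}. e n * e (n + m) * h (n + 2 * m) +
     e n * e (n + 2 * m) * h (n + m) + e (n + m) * e (n + 2 * m) * h n)"
  show thesis
  proof (rule that)
    show "C \<le> 0" unfolding C_def
    proof (intro sum_nonpos)
      fix n m assume m: "m \<in> ?Z - {0}"
      have "e n * e (n + m) * h (n + 2 * m) \<le> 0" "e n * e (n + 2 * m) * h (n + m) \<le> 0"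
        "e (n + m) * e (n + 2 * m) * h n \<le> 0"
        by (intro mult_nonpos_nonneg e2 h ap_terms_distinct[OF p m])+
      then show "e n * e (n + m) * h (n + 2 * m) + e n * e (n + 2 * m) * h (n + m) +
          e (n + m) * e (n + 2 * m) * h n \<le> 0" by linarith
    qed
    fix t
    have "(h n + t * e n) * (h (n + m) + t * e (n + m)) * (h (n + 2 * m) + t * e (n + 2 * m)) =
        h n * h (n + m) * h (n + 2 * m) +
        (e n * h (n + m) * h (n + 2 * m) + h n * e (n + m) * h (n + 2 * m) +
          h n * h (n + m) * e (n + 2 * m)) * t +
        (e n * e (n + m) * h (n + 2 * m) + e n * e (n + 2 * m) * h (n + m) +
          e (n + m) * e (n + 2 * m) * h n) * t\<^sup>2" if "m \<in> ?Z - {0}" for n m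
    proof -
      have expand: "(a + t * a') * (b + t * b') * (c + t * c') = a * b * c +
          (a' * b * c + a * b' * c + a * b * c') * t + (a' * b' * c + a' * c' * b + b' * c' * a) * t\<^sup>2 +
          (a' * b' * c') * t ^ 3" for a a' b b' c c' :: real
        by (simp add: power2_eq_square power3_eq_cube algebra_simps)
      show ?thesis
        unfolding expand using e3[OF ap_terms_distinct[OF p that]] by simp
    qed
    then have "ap_sum_nt p (\<lambda>n. h n + t * e n) = (\<Sum>n\<in>?Z. \<Sum>m\<in>?Z - {0}. h n * h (n + m) * h (n + 2 * m) +
        (e n * h (n + m) * h (n + 2 * m) + h n * e (n + m) * h (n + 2 * m) +
          h n * h (n + m) * e (n + 2 * m)) * t +
        (e n * e (n + m) * h (n + 2 * m) + e n * e (n + 2 * m) * h (n + m) +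
          e (n + m) * e (n + 2 * m) * h n) * t\<^sup>2)"
      unfolding ap_sum_nt_def by (intro sum.cong refl)
    also have "\<dots> = ap_sum_nt p h + B * t + C * t\<^sup>2"
    proof -
      have "B * t = (\<Sum>n\<in>?Z. \<Sum>m\<in>?Z - {0}. (e n * h (n + m) * h (n + 2 * m) +
          h n * e (n + m) * h (n + 2 * m) + h n * h (n + m) * e (n + 2 * m)) * t)"
        unfolding B_def by (simp only: sum_distrib_right)
      moreover have "C * t\<^sup>2 = (\<Sum>n\<in>?Z. \<Sum>m\<in>?Z - {0}. (e n * e (n + m) * h (n + 2 * m) +
          e n * e (n + 2 * m) * h (n + m) + e (n + m) * e (n + 2 * m) * h n) * t\<^sup>2)"
        unfolding C_def by (simp only: sum_distrib_right)
      ultimately show ?thesis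
        by (simp only: ap_sum_nt_def sum.distrib)
    qed
    finally show "ap_sum_nt p (\<lambda>n. h n + t * transfer p x y n) = ap_sum_nt p h + B * t + C * t\<^sup>2"
      by (simp add: e_def)
  qed
qed

lemma sum_of_bool_mod:
  assumes "x \<in> residue_classes p"
  shows "(\<Sum>n\<in>residue_classes p. of_bool (n mod int p = x) :: real) = 1"
proof -
  have "(\<Sum>n\<in>residue_classes p. of_bool (n mod int p = x) :: real) =
      (\<Sum>n\<in>residue_classes p. if n = x then 1 else 0)"
    by (intro sum.cong) (auto simp: residue_classes_mod)
  then show ?thesis using assms by simp
qed

definition fractional :: "nat \<Rightarrow> (int \<Rightarrow> real) \<Rightarrow> int set" where
  "fractional p h = {n \<in> residue_classes p. h n \<noteq> 0 \<and> h n \<noteq> 1}"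

text \<open>A concave function on an interval is smallest at an endpoint. Here an endpoint means
  that the value at \<open>x\<close> or at \<open>y\<close> has become 0 or 1.\<close>

lemma fractional_transfer_step:
  assumes p: "odd p" and h: "periodic p h" "\<And>n. 0 \<le> h n" "\<And>n. h n \<le> 1"
    and xy: "x \<in> fractional p h" "y \<in> fractional p h" "x \<noteq> y"
  obtains h' where "periodic p h'" "\<And>n. 0 \<le> h' n" "\<And>n. h' n \<le> 1"
    "(\<Sum>n\<in>residue_classes p. h' n) = (\<Sum>n\<in>residue_classes p. h n)"
    "ap_sum_nt p h' \<le> ap_sum_nt p h" "fractional p h' \<subset> fractional p h"
proof -
  let ?Z = "residue_classes p"
  have xyZ: "x \<in> ?Z" "y \<in> ?Z" using xy by (auto simp: fractional_def)
  have hx: "0 < h x" "h x < 1" and hy: "0 < h y" "h y < 1"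
    unfolding less_le using xy(1,2) h(2,3) by (auto simp: fractional_def)
  define k where "k t n = h n + t * transfer p x y n" for t n
  obtain B C where C: "C \<le> 0" and "\<And>t. ap_sum_nt p (\<lambda>n. h n + t * transfer p x y n) =
      ap_sum_nt p h + B * t + C * t\<^sup>2"
    by (rule ap_sum_nt_transfer[of p x y h, OF p xy(3) h(2)]) (rule that)
  then have BC: "ap_sum_nt p (k t) = ap_sum_nt p h + B * t + C * t\<^sup>2" for t
    unfolding k_def by blast
  \<comment> \<open>\<open>t2\<close> and \<open>t1\<close> are the largest admissible transfers
    towards \<open>x\<close> and towards \<open>y\<close>. The direction is chosen so that the
    linear term does not increase the count; the quadratic term never does.\<close>
  define t1 where "t1 = min (h x) (1 - h y)"
  define t2 where "t2 = min (1 - h x) (h y)"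
  define t where "t = (if B \<le> 0 then t2 else - t1)"
  have t12: "t1 > 0" "t2 > 0" using hx hy by (auto simp: t1_def t2_def)
  have "B * t \<le> 0"
    using t12 by (auto simp: t_def mult_nonpos_nonneg mult_nonneg_nonpos)
  moreover have "C * t\<^sup>2 \<le> 0" using C by (simp add: mult_nonpos_nonneg)
  ultimately have ap: "ap_sum_nt p (k t) \<le> ap_sum_nt p h" by (simp add: BC)
  have kper: "periodic p (k t)"
    using h(1) by (simp add: periodic_def k_def transfer_def)
  have kx: "k t x = h x + t" and ky: "k t y = h y - t"
    using xyZ xy(3) by (simp_all add: k_def transfer_def residue_classes_mod)
  have kn: "k t n = h n" if "n mod int p \<noteq> x" "n mod int p \<noteq> y" for n
    using that by (simp add: k_def transfer_def)
  have bx: "0 \<le> k t x \<and> k t x \<le> 1" and by': "0 \<le> k t y \<and> k t y \<le> 1"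
    unfolding kx ky using hx hy by (auto simp: t_def t1_def t2_def)
  have b: "0 \<le> k t n \<and> k t n \<le> 1" for n
  proof -
    have "k t (n mod int p) = k t n" by (rule periodicD[OF kper])
    then show ?thesis using bx by' kn[of n] h(2,3)[of n] by (metis (no_types))
  qed
  have "x \<notin> fractional p (k t) \<or> y \<notin> fractional p (k t)"
  proof -
    have "h x + t = 0 \<or> h x + t = 1 \<or> h y - t = 0 \<or> h y - t = 1"
      by (auto simp: t_def t1_def t2_def)
    then show ?thesis by (auto simp: fractional_def kx ky)
  qed
  moreover have "fractional p (k t) \<subseteq> fractional p h"
  proof
    fix n assume n: "n \<in> fractional p (k t)"
    then have "n mod int p = n" by (auto simp: fractional_def residue_classes_mod)
    then show "n \<in> fractional p h"
      using n xy kn[of n] by (cases "n = x \<or> n = y") (auto simp: fractional_def)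
  qed
  ultimately have frac: "fractional p (k t) \<subset> fractional p h" using xy by blast
  have "(\<Sum>n\<in>?Z. k t n) = (\<Sum>n\<in>?Z. h n)"
  proof -
    have "(\<Sum>n\<in>?Z. transfer p x y n) = 0"
      unfolding transfer_def sum_subtractf sum_of_bool_mod[OF xyZ(1)] sum_of_bool_mod[OF xyZ(2)] by simp
    then show ?thesis
      by (simp add: k_def sum.distrib flip: sum_distrib_left)
  qed
  then show thesis
    using that[of "k t"] kper b ap frac by blast
qed

text \<open>Transfers are repeated as long as two fractional points exist. A last one may remain,
  having no partner.\<close>

lemma exists_nearly_integral:
  assumes p: "odd p" and h: "periodic p h" "\<And>n. 0 \<le> h n" "\<And>n. h n \<le> 1"
  shows "\<exists>h'. periodic p h' \<and> (\<forall>n. 0 \<le> h' n \<and> h' n \<le> 1) \<and>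
    (\<Sum>n\<in>residue_classes p. h' n) = (\<Sum>n\<in>residue_classes p. h n) \<and>
    ap_sum_nt p h' \<le> ap_sum_nt p h \<and> card (fractional p h') \<le> 1"
  using h
proof (induction "card (fractional p h)" arbitrary: h rule: less_induct)
  case less
  have fin: "finite (fractional p h)" by (simp add: fractional_def)
  show ?case
  proof (cases "card (fractional p h) \<le> 1")
    case True
    with less.prems show ?thesis by blast
  next
    case False
    then obtain x y where xy: "x \<in> fractional p h" "y \<in> fractional p h" "x \<noteq> y"
      using card_le_Suc0_iff_eq[OF fin] by auto
    from fractional_transfer_step[OF p less.prems xy] obtain h' where
      h': "periodic p h'" "\<And>n. 0 \<le> h' n" "\<And>n. h' n \<le> 1"
        "(\<Sum>n\<in>residue_classes p. h' n) = (\<Sum>n\<in>residue_classes p. h n)"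
        "ap_sum_nt p h' \<le> ap_sum_nt p h" "fractional p h' \<subset> fractional p h" by blast
    have "card (fractional p h') < card (fractional p h)"
      by (rule psubset_card_mono[OF fin h'(6)])
    from less.hyps[OF this h'(1-3)] show ?thesis
      using h'(4,5) by (metis order_trans)
  qed
qed

text \<open>The last fractional value is rounded up, which cannot lower the total. Of the error
  \<open>4 * real p\<close>, three parts bound the progressions having that point as one of their
  three terms, the fourth the trivial progressions.\<close>

lemma exists_set_fewer_progressions:
  assumes p: "odd p" and h: "periodic p h" "\<And>n. 0 \<le> h n" "\<And>n. h n \<le> 1"
  obtains T where "T \<subseteq> residue_classes p" "(\<Sum>n\<in>residue_classes p. h n) \<le> real (card T)"
    "ap_sum p (indicator_mod p T) \<le> ap_sum_nt p h + 4 * real p"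
proof -
  let ?Z = "residue_classes p"
  have p0: "p > 0" using p by (simp add: odd_pos)
  obtain k where k: "periodic p k" "\<And>n. 0 \<le> k n" "\<And>n. k n \<le> 1"
    "(\<Sum>n\<in>?Z. k n) = (\<Sum>n\<in>?Z. h n)" "ap_sum_nt p k \<le> ap_sum_nt p h" "card (fractional p k) \<le> 1"
    using exists_nearly_integral[OF assms] by blast
  have "finite (fractional p k)" by (simp add: fractional_def)
  with k(6) have frac: "\<forall>a\<in>fractional p k. \<forall>b\<in>fractional p k. a = b"
    by (simp add: card_le_Suc0_iff_eq)
  obtain x where x: "x \<in> ?Z" "fractional p k \<subseteq> {x}"
  proof (cases "fractional p k = {}")
    case True
    then show thesis using that[OF mod_in_residue_classes[OF p0, of 0]] by simp
  next
    case False
    then obtain x where "x \<in> fractional p k" by blast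
    then show thesis using that[of x] frac by (auto simp: fractional_def)
  qed
  define T where "T = {n \<in> ?Z. k n > 0}"
  define I where "I = indicator_mod p T"
  define e :: "int \<Rightarrow> real" where "e n = of_bool (n mod int p = x)" for n
  have I01: "0 \<le> I n" "I n \<le> 1" for n by (simp_all add: I_def)
  have e01: "e n = 0 \<or> e n = 1" for n by (simp add: e_def)
  have eper: "periodic p e" by (simp add: periodic_def e_def)
  have sum_e: "(\<Sum>n\<in>?Z. e n) = 1" unfolding e_def by (rule sum_of_bool_mod[OF x(1)])
  have I_eq: "I n = of_bool (k n > 0)" for n
    using periodicD[OF k(1), of n] p0 by (simp add: I_def indicator_mod_def T_def)
  have k_le: "k n \<le> I n" for n using k(2,3)[of n] by (auto simp: I_eq)
  have I_le: "I n \<le> k n" if "e n = 0" for n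
  proof -
    have "n mod int p \<notin> fractional p k" using that x(2) by (auto simp: e_def)
    then have "k n = 0 \<or> k n = 1"
      using p0 periodicD[OF k(1), of n] by (auto simp: fractional_def)
    then show ?thesis by (auto simp: I_eq)
  qed
  have prod_le: "I a * I b * I c \<le> k a * k b * k c + (e a + e b + e c)" for a b c
  proof (cases "e a = 0 \<and> e b = 0 \<and> e c = 0")
    case True
    then have "I a * I b * I c \<le> k a * k b * k c"
      using I_le k(2) I01 by (intro mult_mono mult_nonneg_nonneg) auto
    then show ?thesis using True by simp
  next
    case False
    then have "1 \<le> e a + e b + e c" using e01[of a] e01[of b] e01[of c] by auto
    moreover have "I a * I b * I c \<le> 1" using I01 by (intro mult_le_one mult_nonneg_nonneg) auto
    moreover have "0 \<le> k a * k b * k c" using k(2) by simp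
    ultimately show ?thesis by linarith
  qed
  have "ap_sum_nt p I \<le> (\<Sum>n\<in>?Z. \<Sum>m\<in>?Z - {0}. k n * k (n + m) * k (n + 2 * m) +
      (e n + e (n + m) + e (n + 2 * m)))"
    unfolding ap_sum_nt_def by (intro sum_mono prod_le)
  also have "\<dots> = ap_sum_nt p k + (\<Sum>n\<in>?Z. \<Sum>m\<in>?Z - {0}. e n + e (n + m) + e (n + 2 * m))"
    unfolding ap_sum_nt_def by (simp only: sum.distrib)
  also have "(\<Sum>n\<in>?Z. \<Sum>m\<in>?Z - {0}. e n + e (n + m) + e (n + 2 * m)) \<le>
      (\<Sum>n\<in>?Z. \<Sum>m\<in>?Z. e n + e (n + m) + e (n + 2 * m))"
    by (intro sum_mono sum_mono2) (auto simp: e_def)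
  also have "\<dots> = (\<Sum>n\<in>?Z. \<Sum>m\<in>?Z. e n) + (\<Sum>n\<in>?Z. \<Sum>m\<in>?Z. e (n + m)) + (\<Sum>n\<in>?Z. \<Sum>m\<in>?Z. e (n + 2 * m))"
    by (simp only: sum.distrib)
  also have "(\<Sum>n\<in>?Z. \<Sum>m\<in>?Z. e (n + m)) = real p"
    using sum_shift[OF p0 eper] by (simp add: sum_e add.commute)
  also have "(\<Sum>n\<in>?Z. \<Sum>m\<in>?Z. e (n + 2 * m)) = real p"
    using sum_affine[OF p0 eper, of 2] p by (simp add: sum_e add.commute)
  also have "(\<Sum>n\<in>?Z. \<Sum>m\<in>?Z. e n) = real p"
    by (simp add: sum_e flip: sum_distrib_left)
  finally have nt: "ap_sum_nt p I \<le> ap_sum_nt p h + 3 * real p"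
    using k(5) by simp
  have "(\<Sum>n\<in>?Z. I n ^ 3) \<le> (\<Sum>n\<in>?Z. 1)"
    using I01 by (intro sum_mono power_le_one)
  with nt have "ap_sum p I \<le> ap_sum_nt p h + 4 * real p"
    using ap_sum_eq_ap_sum_nt[OF p0, of I] by simp
  moreover have "(\<Sum>n\<in>?Z. h n) \<le> real (card T)"
  proof -
    have "T \<subseteq> ?Z" by (auto simp: T_def)
    then have "real (card T) = (\<Sum>n\<in>?Z. I n)" by (simp add: I_def sum_indicator_mod)
    moreover have "(\<Sum>n\<in>?Z. k n) \<le> (\<Sum>n\<in>?Z. I n)" by (intro sum_mono k_le)
    ultimately show ?thesis using k(4) by simp
  qed
  ultimately show thesis using that[of T] by (auto simp: T_def I_def)
qed

section \<open>Critical sets\<close>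

text \<open>The budget relative to \<open>p^2\<close>: smoothing costs \<open>6 * \<delta>\<close>,
  as the same \<open>\<delta>\<close> serves for spectrum and Bohr radius; rounding costs
  \<open>4 / real p\<close>; thinning gains \<open>\<beta>\<^sup>2 / 32\<close> of a count that is
  at least \<open>c\<close>. The hypothesis \<open>small\<close> says that the gain prevails,
  \<open>large\<close> is the condition of the second moment argument.\<close>

lemma exists_smooth_near_1:
  assumes p: "prime p" "odd p" and S: "critical_set p d S" and d: "0 < d"
    and c: "c * (real p)\<^sup>2 \<le> ap_sum p (indicator_mod p S)"
    and q: "q > 0" "8 * q \<le> p"
    and \<beta>: "\<beta> = real q / real p" and \<tau>: "\<tau> = \<beta>\<^sup>2 / 128"
    and l: "l > 0" and \<delta>: "\<delta> > 0"
    and b: "\<And>a. a \<in> residue_classes p \<Longrightarrow> norm (dft p (indicator_mod p S) a) > \<delta> * real p \<Longrightarrow>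
        norm (1 - character p (a * b)) \<le> \<delta> / real l"
    and large: "128 * real p \<le> \<beta>\<^sup>2 * (\<tau> * (d * real p))\<^sup>2"
    and small: "6 * \<delta> + 4 / real p < c * \<beta>\<^sup>2 / 32"
  shows "\<exists>n. 1 - \<beta> - \<tau> < smooth b l (indicator_mod p S) n"
proof (rule ccontr)
  let ?Z = "residue_classes p"
  define f where "f = indicator_mod p S"
  define g where "g = smooth b l f"
  assume "\<not> ?thesis"
  then have g_le: "g n \<le> 1 - \<beta> - \<tau>" for n
    by (simp add: g_def f_def not_less)
  have p0: "p > 0" using p(1) by (simp add: prime_gt_0_nat)
  have \<beta>0: "0 < \<beta>" "\<beta> \<le> 1 / 8" using q p0 by (simp_all add: \<beta> field_simps)
  have \<tau>0: "0 < \<tau>" using \<beta>0 by (simp add: \<tau>)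
  have SZ: "S \<subseteq> ?Z" and S_card: "d * real p \<le> real (card S)"
    and crit: "\<And>T. T \<subseteq> ?Z \<Longrightarrow> d * real p \<le> real (card T) \<Longrightarrow>
        card (three_aps p S) \<le> card (three_aps p T)"
    using S by (auto simp: critical_set_def)
  have f: "periodic p f" "\<And>n. 0 \<le> f n" "\<And>n. f n \<le> 1"
    by (simp_all add: f_def periodic_indicator_mod)
  have gper: "periodic p g" unfolding g_def by (rule periodic_smooth[OF f(1)])
  have g0: "0 \<le> g n" for n
    unfolding g_def smooth_def using f(2) by (intro divide_nonneg_nonneg sum_nonneg) auto
  have D: "real (card S) = (\<Sum>n\<in>?Z. g n)"
    unfolding g_def using sum_smooth[OF p0 f(1) l] SZ by (simp add: f_def sum_indicator_mod)
  \<comment> \<open>The extra \<open>\<tau>\<close> below \<open>1 - \<beta>\<close> makes room for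
    the overshoot.\<close>
  have g_le': "g n * (1 + \<tau>) \<le> 1 - \<beta>" for n
  proof -
    have "g n * (1 + \<tau>) \<le> (1 - \<beta> - \<tau>) * (1 + \<tau>)"
      using g_le \<tau>0 by (intro mult_right_mono) auto
    also have "\<dots> = 1 - \<beta> - \<beta> * \<tau> - \<tau> * \<tau>" by (simp add: algebra_simps)
    also have "\<dots> \<le> 1 - \<beta>"
    proof -
      have "0 \<le> \<beta> * \<tau>" "0 \<le> \<tau> * \<tau>" using \<beta>0 \<tau>0 by simp_all
      then show ?thesis by linarith
    qed
    finally show ?thesis .
  qed
  have large': "128 * real p \<le> \<beta>\<^sup>2 * (\<tau> * real (card S))\<^sup>2"
  proof -
    have "\<beta>\<^sup>2 * (\<tau> * (d * real p))\<^sup>2 \<le> \<beta>\<^sup>2 * (\<tau> * real (card S))\<^sup>2"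
      using S_card \<tau>0 d by (intro mult_left_mono power_mono) auto
    then show ?thesis using large by linarith
  qed
  obtain h where h: "periodic p h" "\<And>n. 0 \<le> h n" "\<And>n. h n \<le> 1"
    "real (card S) \<le> (\<Sum>n\<in>?Z. h n)" "ap_sum_nt p h \<le> ap_sum_nt p g * (1 - \<beta>\<^sup>2 / 32)"
    by (rule exists_fewer_progressions[OF p gper g0 q \<beta> \<tau> g_le' D large']) (rule that)
  obtain T where T: "T \<subseteq> ?Z" "(\<Sum>n\<in>?Z. h n) \<le> real (card T)"
    "ap_sum p (indicator_mod p T) \<le> ap_sum_nt p h + 4 * real p"
    by (rule exists_set_fewer_progressions[OF p(2) h(1-3)]) (rule that)
  have "card (three_aps p S) \<le> card (three_aps p T)"
    using T h(4) S_card by (intro crit) auto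
  then have "real (card (three_aps p S)) \<le> real (card (three_aps p T))" by simp
  then have "ap_sum p f \<le> ap_sum p (indicator_mod p T)"
    using card_three_aps_eq_ap_sum[OF p0 SZ] card_three_aps_eq_ap_sum[OF p0 T(1)] by (simp add: f_def)
  also have "\<dots> \<le> ap_sum_nt p g * (1 - \<beta>\<^sup>2 / 32) + 4 * real p"
    using T(3) h(5) by linarith
  also have "ap_sum_nt p g * (1 - \<beta>\<^sup>2 / 32) \<le> (ap_sum p f + 6 * \<delta> * (real p)\<^sup>2) * (1 - \<beta>\<^sup>2 / 32)"
  proof (rule mult_right_mono)
    have "0 \<le> (\<Sum>n\<in>?Z. g n ^ 3)" using g0 by (intro sum_nonneg) auto
    then have "ap_sum_nt p g \<le> ap_sum p g"
      using ap_sum_eq_ap_sum_nt[OF p0, of g] by simp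
    moreover have "\<bar>ap_sum p f - ap_sum p g\<bar> \<le> (4 * \<delta> + 2 * \<delta>) * (real p)\<^sup>2"
      unfolding g_def using \<delta> b
      by (intro ap_sum_smooth_le[OF p0 p(2) f l]) (auto simp: f_def)
    ultimately show "ap_sum_nt p g \<le> ap_sum p f + 6 * \<delta> * (real p)\<^sup>2"
      by (simp add: abs_le_iff)
    have "\<beta>\<^sup>2 \<le> 1" using \<beta>0 by (intro power_le_one) auto
    then show "0 \<le> 1 - \<beta>\<^sup>2 / 32" by simp
  qed
  finally have "ap_sum p f * (\<beta>\<^sup>2 / 32) \<le> 6 * \<delta> * (real p)\<^sup>2 * (1 - \<beta>\<^sup>2 / 32) + 4 * real p"
    by (simp add: algebra_simps)
  also have "6 * \<delta> * (real p)\<^sup>2 * (1 - \<beta>\<^sup>2 / 32) \<le> 6 * \<delta> * (real p)\<^sup>2 * 1"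
    using \<delta> by (intro mult_left_mono) auto
  also have "6 * \<delta> * (real p)\<^sup>2 * 1 + 4 * real p = (6 * \<delta> + 4 / real p) * (real p)\<^sup>2"
    using p0 by (simp add: field_simps power2_eq_square)
  also have "\<dots> < c * \<beta>\<^sup>2 / 32 * (real p)\<^sup>2"
    using small p0 by (intro mult_strict_right_mono) auto
  also have "\<dots> = c * (real p)\<^sup>2 * (\<beta>\<^sup>2 / 32)" by simp
  also have "\<dots> \<le> ap_sum p f * (\<beta>\<^sup>2 / 32)"
    using c by (intro mult_right_mono) (auto simp: f_def)
  finally show False by simp
qed

text \<open>As \<open>M ^ nat \<lfloor>1 / \<delta>\<^sup>2\<rfloor> < p\<close>, the Bohr set has
  an element \<open>b\<close> other than 0. Since \<open>p\<close> is prime and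
  \<open>l \<le> p\<close>, the multiples of \<open>b\<close> give \<open>l\<close> distinct terms,
  and the value of the smoothed indicator is their density in \<open>S\<close>.\<close>

lemma exists_dense_progression:
  assumes p: "prime p" "odd p" and S: "critical_set p d S" and d: "0 < d"
    and c: "c * (real p)\<^sup>2 \<le> ap_sum p (indicator_mod p S)"
    and q: "q > 0" "8 * q \<le> p"
    and \<beta>: "\<beta> = real q / real p" and \<tau>: "\<tau> = \<beta>\<^sup>2 / 128"
    and l: "l > 0" "l \<le> p" and \<delta>: "\<delta> > 0"
    and M: "2 * pi * real l / \<delta> \<le> real M" "M ^ nat \<lfloor>1 / \<delta>\<^sup>2\<rfloor> < p"
    and large: "128 * real p \<le> \<beta>\<^sup>2 * (\<tau> * (d * real p))\<^sup>2"
    and small: "6 * \<delta> + 4 / real p < c * \<beta>\<^sup>2 / 32"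
  obtains N where "is_ap_mod p l N" "real l * (1 - \<beta> - \<tau>) < real (card (S \<inter> N))"
proof -
  let ?Z = "residue_classes p"
  define f where "f = indicator_mod p S"
  have p0: "p > 0" using p(1) by (simp add: prime_gt_0_nat)
  have SZ: "S \<subseteq> ?Z" using S by (simp add: critical_set_def)
  have "0 < 2 * pi * real l / \<delta>" using l \<delta> by simp
  then have "0 < real M" using M(1) by linarith
  then have M0: "M > 0" by simp
  have M_le: "2 * pi / real M \<le> \<delta> / real l"
    using M(1) M0 \<delta> l by (simp add: field_simps)
  define R where "R = {a \<in> ?Z. norm (dft p f a) > \<delta> * real p}"
  define B where "B = {b \<in> ?Z. \<forall>a\<in>R. norm (1 - character p (a * b)) \<le> 2 * pi / real M}"
  have "real (card R) \<le> 1 / \<delta>\<^sup>2"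
    unfolding R_def by (rule card_large_spectrum_le[OF p0 _ _ \<delta>]) (simp_all add: f_def)
  then have "card R \<le> nat \<lfloor>1 / \<delta>\<^sup>2\<rfloor>" by (simp add: le_nat_floor)
  then have "M ^ card R \<le> M ^ nat \<lfloor>1 / \<delta>\<^sup>2\<rfloor>" using M0 by (intro power_increasing) auto
  with M(2) have M_lt: "M ^ card R < p" by linarith
  have "p \<le> M ^ card R * card B"
    unfolding B_def by (rule card_bohr_set_ge[OF p0 _ M0]) (simp add: R_def)
  have "\<not> B \<subseteq> {0}"
  proof
    assume "B \<subseteq> {0}"
    then have "card B \<le> 1" using card_mono[of "{0}" B] by simp
    then have "M ^ card R * card B \<le> M ^ card R * 1" by (rule mult_le_mono2)
    with \<open>p \<le> M ^ card R * card B\<close> M_lt show False by simp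
  qed
  then obtain b where b: "b \<in> B" "b \<noteq> 0" by blast
  have "norm (1 - character p (a * b)) \<le> \<delta> / real l"
    if "a \<in> ?Z" "norm (dft p (indicator_mod p S) a) > \<delta> * real p" for a
    using b(1) that M_le by (force simp: B_def R_def f_def)
  then obtain n where n: "1 - \<beta> - \<tau> < smooth b l f n"
    using exists_smooth_near_1[OF p S d c q \<beta> \<tau> l(1) \<delta> _ large small] by (auto simp: f_def)
  define t where "t j = (n + int j * b) mod int p" for j
  have inj: "inj_on t {..<l}"
  proof (rule inj_onI)
    fix i j assume ij: "i \<in> {..<l}" "j \<in> {..<l}" "t i = t j"
    then have "[n + int i * b = n + int j * b] (mod int p)"
      by (simp add: t_def unique_euclidean_semiring_class.cong_def)
    then have "[int i * b = int j * b] (mod int p)" by (simp only: cong_add_lcancel)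
    moreover have "coprime b (int p)"
      using b by (intro coprime_residue_class p) (auto simp: B_def)
    ultimately have "[int i = int j] (mod int p)" by (simp add: cong_mult_rcancel)
    then have "int i = int j"
      using ij l(2) by (intro residue_classes_cong_imp_eq) (auto simp: residue_classes_def)
    then show "i = j" by simp
  qed
  show thesis
  proof (rule that[of "t ` {..<l}"])
    show "is_ap_mod p l (t ` {..<l})"
      unfolding is_ap_mod_def using card_image[OF inj] by (auto simp: t_def)
    have "real l * smooth b l f n = (\<Sum>j<l. f (n + int j * b))"
      using l by (simp add: smooth_def)
    also have "\<dots> = (\<Sum>j<l. if t j \<in> S then 1 else 0)"
      by (intro sum.cong) (auto simp: f_def indicator_mod_def t_def)
    also have "\<dots> = real (card ({..<l} \<inter> {j. t j \<in> S}))"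
      by (simp add: sum.If_cases)
    also have "card ({..<l} \<inter> {j. t j \<in> S}) = card (t ` ({..<l} \<inter> {j. t j \<in> S}))"
      by (rule card_image[symmetric], rule inj_on_subset[OF inj]) auto
    also have "t ` ({..<l} \<inter> {j. t j \<in> S}) = S \<inter> t ` {..<l}" by auto
    finally show "real l * (1 - \<beta> - \<tau>) < real (card (S \<inter> t ` {..<l}))"
      using n l by (metis mult_strict_left_mono of_nat_0_less_iff)
  qed
qed

section \<open>From a dense progression to one contained in the set\<close>

text \<open>Pigeonhole on the \<open>l div r\<close> blocks of \<open>r\<close> consecutive terms:
  fewer than \<open>l * x\<close> terms are missing from \<open>S\<close>, so they cannot hit every
  block.\<close>

lemma exists_subprogression:
  assumes N: "is_ap_mod p l N" and r: "0 < r" "r \<le> l" "2 * real r * x \<le> 1"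
    and dense: "real (card N) * (1 - x) < real (card (S \<inter> N))"
  obtains N' where "is_ap_mod p r N'" "N' \<subseteq> S"
proof -
  obtain a b where N_eq: "N = (\<lambda>j. (a + int j * b) mod int p) ` {..<l}" and cardN: "card N = l"
    using N by (auto simp: is_ap_mod_def)
  define t where "t j = (a + int j * b) mod int p" for j
  have N_t: "N = t ` {..<l}" by (simp add: N_eq t_def)
  then have inj: "inj_on t {..<l}" using cardN by (intro eq_card_imp_inj_on) auto
  define J where "J = {j. j < l \<and> t j \<notin> S}"
  have finJ: "finite J" by (simp add: J_def)
  have "card (S \<inter> N) + card J = l"
  proof -
    have "S \<inter> N = t ` ({..<l} - J)" by (auto simp: N_t J_def)
    then have "card (S \<inter> N) = card ({..<l} - J)"
      using card_image[OF inj_on_subset[OF inj, of "{..<l} - J"]] by auto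
    moreover have "J \<subseteq> {..<l}" by (auto simp: J_def)
    then have "card ({..<l} - J) = l - card J" "card J \<le> l"
      using card_Diff_subset[OF finJ] card_mono[of "{..<l}" J] by auto
    ultimately show ?thesis by simp
  qed
  then have J_lt: "real (card J) < real l * x"
    using dense cardN by (simp add: algebra_simps flip: of_nat_add)
  have "\<exists>i < l div r. \<forall>j<r. t (i * r + j) \<in> S"
  proof (rule ccontr)
    assume no: "\<not> (\<exists>i < l div r. \<forall>j<r. t (i * r + j) \<in> S)"
    have "{..<l div r} \<subseteq> (\<lambda>j. j div r) ` J"
    proof
      fix i assume i: "i \<in> {..<l div r}"
      with no obtain j where j: "j < r" "t (i * r + j) \<notin> S" by auto
      have "(i + 1) * r \<le> l div r * r" using i by (intro mult_right_mono) auto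
      also have "\<dots> \<le> l" by (rule div_times_less_eq_dividend)
      finally have "i * r + j < l" using j by simp
      then have "i * r + j \<in> J" using j by (simp add: J_def)
      moreover have "(i * r + j) div r = i" using j by simp
      ultimately show "i \<in> (\<lambda>j. j div r) ` J" by (metis image_eqI)
    qed
    then have "l div r \<le> card J"
      using surj_card_le[OF finJ] by fastforce
    \<comment> \<open>One complete block exists, so the incomplete last block at most doubles the
      length: \<open>l < 2 * r * (l div r)\<close>. This is the origin of the factor 2 in the
      hypothesis on \<open>x\<close>.\<close>
    have "1 \<le> l div r" using r by (simp add: Suc_le_eq div_greater_zero_iff)
    then have "r \<le> r * (l div r)" using r(1) by simp
    moreover have "l < r * (l div r) + r"
      using mod_less_divisor[OF r(1), of l] mult_div_mod_eq[of r l] by linarith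
    moreover have "r * (l div r) \<le> r * card J" using \<open>l div r \<le> card J\<close> by simp
    ultimately have "l < 2 * (r * card J)" by linarith
    then have "l < 2 * r * card J" by (simp only: mult.assoc)
    then have "real l < 2 * real r * real (card J)"
      by (metis of_nat_less_iff of_nat_mult of_nat_numeral)
    also have "\<dots> < 2 * real r * (real l * x)"
      using J_lt r(1) by (intro mult_strict_left_mono) auto
    also have "\<dots> = real l * (2 * real r * x)" by simp
    also have "\<dots> \<le> real l * 1" by (intro mult_left_mono r(3)) simp
    finally show False by simp
  qed
  then obtain i where i: "i < l div r" "\<And>j. j < r \<Longrightarrow> t (i * r + j) \<in> S" by blast
  define u where "u j = t (i * r + j)" for j
  have bound: "i * r + j < l" if "j < r" for j
  proof -
    have "(i + 1) * r \<le> l div r * r" using i by (intro mult_right_mono) auto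
    also have "\<dots> \<le> l" by (rule div_times_less_eq_dividend)
    finally show ?thesis using that by simp
  qed
  have "inj_on u {..<r}"
  proof (rule inj_onI)
    fix j k assume "j \<in> {..<r}" "k \<in> {..<r}" "u j = u k"
    then have "i * r + j = i * r + k"
      using bound by (intro inj_onD[OF inj]) (auto simp: u_def)
    then show "j = k" by simp
  qed
  then have "card (u ` {..<r}) = r" by (simp add: card_image)
  moreover have "u = (\<lambda>j. (a + int (i * r) * b + int j * b) mod int p)"
    by (auto simp: u_def t_def algebra_simps)
  ultimately have "is_ap_mod p r (u ` {..<r})"
    unfolding is_ap_mod_def by blast
  moreover have "u ` {..<r} \<subseteq> S" using i(2) by (auto simp: u_def)
  ultimately show thesis by (rule that)
qed

section \<open>Asymptotic choice of the parameters\<close>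

text \<open>Evaluated at \<open>y = ln p\<close>. The correction
  \<open>y powr (1 / sqrt (ln y)) = exp (sqrt (ln y))\<close> beats every power of
  \<open>ln y\<close>, hence every constant and every \<open>ln (ln p)\<close>, while its exponent
  tends to 0. The shape \<open>1 / 4 + - 1 / ...\<close> matches \<open>1/4 + \<epsilon> p\<close>
  syntactically.\<close>

definition slack :: "real \<Rightarrow> real" where
  "slack y = 1 / y powr (1 / 4 + - 1 / sqrt (ln y))"

lemma critical_set_dense_progression:
  fixes d L :: real
  assumes d: "0 < d" and L: "L \<ge> 1"
  shows "\<forall>\<^sub>F p in sequentially. prime p \<longrightarrow> (\<forall>S. critical_set p d S \<longrightarrow>
    (\<exists>l N. is_ap_mod p l N \<and> ln (real p) powr L \<le> real l \<and>
      real (card N) * (1 - slack (ln (real p))) < real (card (S \<inter> N))))"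
proof -
  obtain c where c: "c > 0" "\<And>p S. odd p \<Longrightarrow> S \<subseteq> residue_classes p \<Longrightarrow> d * real p \<le> real (card S) \<Longrightarrow>
      c * (real p)\<^sup>2 \<le> ap_sum p (indicator_mod p S)"
    by (rule varnavides[OF d]) (rule that)
  \<comment> \<open>As \<open>\<beta> \<ge> x / 4\<close>, the gain is at least
    \<open>c * x\<^sup>2 / 512\<close>. With this \<open>\<kappa>\<close> the smoothing error
    \<open>6 * \<delta>\<close> is exactly half of that; the condition
    \<open>4096 / c < x\<^sup>2 * real p\<close> leaves the other half for
    \<open>4 / real p\<close>.\<close>
  define \<kappa> where "\<kappa> = c / 6144"
  have \<kappa>: "\<kappa> > 0" using c by (simp add: \<kappa>_def)
  \<comment> \<open>Inserting \<open>\<tau> = \<beta>\<^sup>2 / 128\<close> and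
    \<open>\<beta> \<ge> x / 4\<close> into the second moment condition gives
    \<open>C \<le> x ^ 6 * real p\<close>.\<close>
  define C where "C = 128 ^ 3 * 4 ^ 6 / d\<^sup>2"
  have lim: "filterlim (\<lambda>p. ln (real p)) at_top sequentially" by real_asymp
  have "\<forall>\<^sub>F y in at_top. slack y \<le> 1 / 4" unfolding slack_def by real_asymp
  moreover have "\<forall>\<^sub>F y in at_top. 4 \<le> slack y * exp y" unfolding slack_def by real_asymp
  moreover have "\<forall>\<^sub>F y in at_top. C \<le> slack y ^ 6 * exp y" unfolding slack_def by real_asymp
  moreover have "\<forall>\<^sub>F y in at_top. 4096 / c < slack y ^ 2 * exp y" unfolding slack_def by real_asymp
  moreover have "\<forall>\<^sub>F y::real in at_top. y powr L + 1 \<le> exp y" by real_asymp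
  \<comment> \<open>The logarithm of the pigeonhole condition, with the numerator bounding
    \<open>ln M\<close>. That numerator is of order \<open>ln y\<close>, and division by the squared
    \<open>\<delta>\<close> multiplies it by a constant times
    \<open>y * exp (- 4 * sqrt (ln y))\<close>.\<close>
  moreover have "\<forall>\<^sub>F y::real in at_top.
      ln (2 * pi * (y powr L + 1) / (\<kappa> * slack y ^ 2) + 1) / (\<kappa> * slack y ^ 2) ^ 2 < y"
    unfolding slack_def using \<kappa> L by real_asymp
  moreover have "\<forall>\<^sub>F y::real in at_top. y > 1" by (rule eventually_gt_at_top)
  ultimately have "\<forall>\<^sub>F y in at_top. slack y \<le> 1 / 4 \<and> 4 \<le> slack y * exp y \<and> C \<le> slack y ^ 6 * exp y \<and>
      4096 / c < slack y ^ 2 * exp y \<and> y powr L + 1 \<le> exp y \<and>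
      ln (2 * pi * (y powr L + 1) / (\<kappa> * slack y ^ 2) + 1) / (\<kappa> * slack y ^ 2) ^ 2 < y \<and> y > 1"
    by (simp add: eventually_conj_iff)
  from eventually_compose_filterlim[OF this lim] show ?thesis
    using eventually_gt_at_top[of 2]
  proof eventually_elim
    case (elim p)
    define y where "y = ln (real p)"
    define x where "x = slack y"
    have p2: "p > 2" using elim by simp
    have exp_y: "exp y = real p" using p2 by (simp add: y_def)
    have x: "x \<le> 1 / 4" "4 \<le> x * real p" "C \<le> x ^ 6 * real p" "4096 / c < x\<^sup>2 * real p"
      and yL: "y powr L + 1 \<le> real p" and y1: "y > 1"
      and ln_lt: "ln (2 * pi * (y powr L + 1) / (\<kappa> * x\<^sup>2) + 1) / (\<kappa> * x\<^sup>2)\<^sup>2 < y"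
      using elim exp_y unfolding x_def y_def by auto
    have x0: "x > 0" using y1 by (simp add: x_def slack_def)
    \<comment> \<open>Aiming at \<open>\<beta> = x / 2\<close> leaves room for
      \<open>\<beta> + \<tau> \<le> x\<close>; rounding down keeps
      \<open>\<beta> \<ge> x / 4\<close> because \<open>x * real p \<ge> 4\<close>.\<close>
    define q where "q = nat \<lfloor>x * real p / 2\<rfloor>"
    define \<beta> where "\<beta> = real q / real p"
    define \<tau> where "\<tau> = \<beta>\<^sup>2 / 128"
    define l where "l = nat \<lceil>y powr L\<rceil>"
    define \<delta> where "\<delta> = \<kappa> * x\<^sup>2"
    define M where "M = nat \<lceil>2 * pi * real l / \<delta>\<rceil>"
    have q_bounds: "x * real p / 4 \<le> real q" "real q \<le> x * real p / 2"
      using x(2) unfolding q_def by linarith+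
    have q0: "q > 0" using q_bounds(1) x(2) by (intro Nat.gr0I) auto
    have "8 * real q \<le> 8 * (x * real p / 2)" using q_bounds(2) by simp
    also have "\<dots> \<le> real p" using x(1) p2 mult_right_mono[of x "1 / 4" "real p"] by simp
    finally have q8: "8 * q \<le> p" by linarith
    have \<beta>: "x / 4 \<le> \<beta>" "\<beta> \<le> x / 2"
      using q_bounds p2 by (simp_all add: \<beta>_def field_simps)
    have \<beta>0: "0 \<le> \<beta>" "\<beta> \<le> 1" using \<beta> x0 x(1) by auto
    have "\<beta>\<^sup>2 \<le> \<beta>" using \<beta>0 by (simp add: power2_eq_square mult_left_le_one_le)
    then have \<beta>\<tau>: "\<beta> + \<tau> \<le> x" using \<beta> \<beta>0 unfolding \<tau>_def by linarith
    have \<delta>: "\<delta> > 0" using \<kappa> x0 by (simp add: \<delta>_def)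
    have yL0: "0 < y powr L" using y1 by simp
    have l: "y powr L \<le> real l" "real l \<le> y powr L + 1" "l > 0"
      using yL0 unfolding l_def by linarith+
    have l_le: "l \<le> p" using l(2) yL by linarith
    have quot0: "0 < 2 * pi * real l / \<delta>" using l \<delta> by simp
    have M: "2 * pi * real l / \<delta> \<le> real M" "real M \<le> 2 * pi * real l / \<delta> + 1" "M > 0"
      using quot0 unfolding M_def by linarith+
    have M_pow: "M ^ nat \<lfloor>1 / \<delta>\<^sup>2\<rfloor> < p"
    proof -
      let ?A = "2 * pi * (y powr L + 1) / \<delta> + 1"
      have "2 * pi * real l / \<delta> \<le> 2 * pi * (y powr L + 1) / \<delta>"
        using l(2) \<delta> by (intro divide_right_mono mult_left_mono) auto
      then have "real M \<le> ?A" using M(2) by linarith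
      then have lnM: "0 \<le> ln (real M)" "ln (real M) \<le> ln ?A" using M(3) by (simp_all add: ln_le_cancel_iff)
      have "real (nat \<lfloor>1 / \<delta>\<^sup>2\<rfloor>) * ln (real M) \<le> 1 / \<delta>\<^sup>2 * ln ?A"
        using lnM \<delta> by (intro mult_mono) auto
      also have "\<dots> < y" using ln_lt by (simp add: \<delta>_def)
      finally have "ln (real M ^ nat \<lfloor>1 / \<delta>\<^sup>2\<rfloor>) < ln (real p)"
        using M(3) by (simp add: ln_realpow y_def)
      then have "real M ^ nat \<lfloor>1 / \<delta>\<^sup>2\<rfloor> < real p"
        using M(3) p2 by (subst (asm) ln_less_cancel_iff) auto
      then show ?thesis by (metis of_nat_less_iff of_nat_power)
    qed
    have large: "128 * real p \<le> \<beta>\<^sup>2 * (\<tau> * (d * real p))\<^sup>2"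
    proof -
      have "128 ^ 3 * 4 ^ 6 \<le> d\<^sup>2 * (x ^ 6 * real p)"
        using x(3) d by (simp add: C_def field_simps)
      then have "128 ^ 3 * real p \<le> d\<^sup>2 * (x / 4) ^ 6 * real p * real p"
        using p2 by (simp add: power_divide field_simps)
      also have "\<dots> \<le> d\<^sup>2 * \<beta> ^ 6 * real p * real p"
        using \<beta> x0 by (intro mult_right_mono mult_left_mono power_mono) auto
      finally show ?thesis
        by (simp add: \<tau>_def power2_eq_square power_numeral_reduce field_simps)
    qed
    have small: "6 * \<delta> + 4 / real p < c * \<beta>\<^sup>2 / 32"
    proof -
      have "4 / real p < c * x\<^sup>2 / 1024"
        using x(4) c(1) p2 by (simp add: field_simps)
      then have "6 * \<delta> + 4 / real p < c * (x / 4)\<^sup>2 / 32"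
        by (simp add: \<delta>_def \<kappa>_def power2_eq_square)
      also have "\<dots> \<le> c * \<beta>\<^sup>2 / 32"
        using c(1) \<beta> x0 by (intro divide_right_mono mult_left_mono power_mono) auto
      finally show ?thesis .
    qed
    show ?case
    proof (intro impI allI)
      fix S assume p: "prime p" and S: "critical_set p d S"
      have odd: "odd p" using p p2 by (simp add: prime_odd_nat)
      have "c * (real p)\<^sup>2 \<le> ap_sum p (indicator_mod p S)"
        using S by (intro c(2) odd) (auto simp: critical_set_def)
      then obtain N where N: "is_ap_mod p l N" "real l * (1 - \<beta> - \<tau>) < real (card (S \<inter> N))"
        using exists_dense_progression[OF p odd S d _ q0 q8 \<beta>_def \<tau>_def l(3) l_le \<delta> M(1) M_pow large small]
        by blast
      have "real (card N) = real l" using N(1) by (simp add: is_ap_mod_def)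
      moreover have "real l * (1 - x) \<le> real l * (1 - \<beta> - \<tau>)"
        using \<beta>\<tau> by (intro mult_left_mono) auto
      ultimately have "real (card N) * (1 - slack (ln (real p))) < real (card (S \<inter> N))"
        using N(2) by (simp add: x_def y_def)
      then show "\<exists>l N. is_ap_mod p l N \<and> ln (real p) powr L \<le> real l \<and>
          real (card N) * (1 - slack (ln (real p))) < real (card (S \<inter> N))"
        using N(1) l(1) by (auto simp: y_def)
    qed
  qed
qed

text \<open>The exponent gives up \<open>2 / sqrt (ln y)\<close> where \<open>slack\<close> gives up
  \<open>1 / sqrt (ln y)\<close>, so the product of length and \<open>slack\<close> tends to 0 and
  the block argument applies.\<close>

lemma critical_set_progression:
  fixes d :: real
  assumes d: "0 < d"
  shows "\<forall>\<^sub>F p in sequentially. prime p \<longrightarrow> (\<forall>S. critical_set p d S \<longrightarrow>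
    (\<exists>l N. is_ap_mod p l N \<and> N \<subseteq> S \<and>
      ln (real p) powr (1 / 4 + - 2 / sqrt (ln (ln (real p)))) \<le> real l))"
proof -
  have lim: "filterlim (\<lambda>p. ln (real p)) at_top sequentially" by real_asymp
  have "\<forall>\<^sub>F y::real in at_top. y powr (- 1 / sqrt (ln y)) \<le> 1 / 4" by real_asymp
  moreover have "\<forall>\<^sub>F y in at_top. slack y \<le> 1 / 4" unfolding slack_def by real_asymp
  moreover have "\<forall>\<^sub>F y::real in at_top. y powr (1 / 4 + - 2 / sqrt (ln y)) + 1 \<le> y" by real_asymp
  moreover have "\<forall>\<^sub>F y::real in at_top. y > 1" by (rule eventually_gt_at_top)
  ultimately have "\<forall>\<^sub>F y::real in at_top. y powr (- 1 / sqrt (ln y)) \<le> 1 / 4 \<and> slack y \<le> 1 / 4 \<and>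
      y powr (1 / 4 + - 2 / sqrt (ln y)) + 1 \<le> y \<and> y > 1"
    by (simp add: eventually_conj_iff)
  \<comment> \<open>\<open>order_refl\<close> selects \<open>L = 1\<close>; a dense progression of
    length \<open>ln p\<close> is long enough to contain a block of \<open>r\<close> terms.\<close>
  from eventually_compose_filterlim[OF this lim] critical_set_dense_progression[OF d order_refl]
  show ?thesis
  proof eventually_elim
    case (elim p)
    define y where "y = ln (real p)"
    define z where "z = y powr (1 / 4 + - 2 / sqrt (ln y))"
    define r where "r = nat \<lceil>z\<rceil>"
    have y: "y powr (- 1 / sqrt (ln y)) \<le> 1 / 4" "slack y \<le> 1 / 4" "z + 1 \<le> y" "y > 1"
      using elim by (simp_all add: y_def z_def)
    have "0 < z" using y(4) by (simp add: z_def)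
    then have r: "z \<le> real r" "real r \<le> z + 1" "0 < r" unfolding r_def by linarith+
    have slack0: "0 < slack y" using y(4) by (simp add: slack_def)
    have "z * slack y = y powr ((1 / 4 + - 2 / sqrt (ln y)) - (1 / 4 + - 1 / sqrt (ln y)))"
      unfolding powr_diff by (simp add: z_def slack_def)
    also have "(1 / 4 + - 2 / sqrt (ln y)) - (1 / 4 + - 1 / sqrt (ln y)) = - 1 / sqrt (ln y)"
      by (simp flip: diff_divide_distrib)
    finally have "z * slack y \<le> 1 / 4" using y(1) by simp
    moreover have "real r * slack y \<le> (z + 1) * slack y"
      using r slack0 by (intro mult_right_mono) auto
    \<comment> \<open>Rounding \<open>z\<close> up to \<open>r\<close> adds at most one
      \<open>slack y\<close>: the bounds 1/4 on \<open>z * slack y\<close> and on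
      \<open>slack y\<close> add up to 1/2.\<close>
    ultimately have r_slack: "2 * real r * slack y \<le> 1"
      using y(2) by (simp add: distrib_right)
    show ?case
    proof (intro impI allI)
      fix S assume "prime p" "critical_set p d S"
      with elim obtain l N where N: "is_ap_mod p l N" "y powr 1 \<le> real l"
        "real (card N) * (1 - slack y) < real (card (S \<inter> N))"
        unfolding y_def by blast
      have "r \<le> l" using r(2) y(3,4) N(2) by simp
      obtain N' where "is_ap_mod p r N'" "N' \<subseteq> S"
        by (rule exists_subprogression[OF N(1) r(3) \<open>r \<le> l\<close> r_slack N(3)]) (rule that)
      then show "\<exists>l N. is_ap_mod p l N \<and> N \<subseteq> S \<and>
          ln (real p) powr (1 / 4 + - 2 / sqrt (ln (ln (real p)))) \<le> real l"
        using r(1) by (auto simp: z_def y_def)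
    qed
  qed
qed

theorem theorem1:
  shows "(\<forall>d::real. 0 < d \<and> d \<le> 1 \<longrightarrow>
           (\<exists>\<epsilon> :: nat \<Rightarrow> real. \<epsilon> \<longlonglongrightarrow> 0 \<and>
             (\<forall>\<^sub>F p in sequentially. prime p \<longrightarrow>
               (\<forall>S. critical_set p d S \<longrightarrow>
                 (\<exists>l N. is_ap_mod p l N \<and> N \<subseteq> S \<and>
                    real l \<ge> ln (real p) powr (1/4 + \<epsilon> p))))))
       \<and> (\<forall>(L::real) d::real. L \<ge> 1 \<and> 0 < d \<and> d \<le> 1 \<longrightarrow>
           (\<exists>\<epsilon> :: nat \<Rightarrow> real. \<epsilon> \<longlonglongrightarrow> 0 \<and>
             (\<forall>\<^sub>F p in sequentially. prime p \<longrightarrow>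
               (\<forall>S. critical_set p d S \<longrightarrow>
                 (\<exists>l N. is_ap_mod p l N \<and> real l \<ge> ln (real p) powr L \<and>
                    real (card (S \<inter> N)) >
                      real (card N) * (1 - 1 / ln (real p) powr (1/4 + \<epsilon> p)))))))"
proof (intro conjI allI impI)
  fix d :: real assume d: "0 < d \<and> d \<le> 1"
  have "(\<lambda>p::nat. - 2 / sqrt (ln (ln (real p)))) \<longlonglongrightarrow> 0" by real_asymp
  with d show "\<exists>\<epsilon> :: nat \<Rightarrow> real. \<epsilon> \<longlonglongrightarrow> 0 \<and>
             (\<forall>\<^sub>F p in sequentially. prime p \<longrightarrow>
               (\<forall>S. critical_set p d S \<longrightarrow>
                 (\<exists>l N. is_ap_mod p l N \<and> N \<subseteq> S \<and>
                    real l \<ge> ln (real p) powr (1/4 + \<epsilon> p))))"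
    by (intro exI[of _ "\<lambda>p. - 2 / sqrt (ln (ln (real p)))"] conjI critical_set_progression) auto
next
  fix L d :: real assume "L \<ge> 1 \<and> 0 < d \<and> d \<le> 1"
  moreover have "(\<lambda>p::nat. - 1 / sqrt (ln (ln (real p)))) \<longlonglongrightarrow> 0" by real_asymp
  ultimately show "\<exists>\<epsilon> :: nat \<Rightarrow> real. \<epsilon> \<longlonglongrightarrow> 0 \<and>
             (\<forall>\<^sub>F p in sequentially. prime p \<longrightarrow>
               (\<forall>S. critical_set p d S \<longrightarrow>
                 (\<exists>l N. is_ap_mod p l N \<and> real l \<ge> ln (real p) powr L \<and>
                    real (card (S \<inter> N)) >
                      real (card N) * (1 - 1 / ln (real p) powr (1/4 + \<epsilon> p)))))"
    using critical_set_dense_progression[of d L]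
    by (intro exI[of _ "\<lambda>p. - 1 / sqrt (ln (ln (real p)))"]) (simp only: slack_def simp_thms)
qed

end
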